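(* Given a bounded 0-C1PVASS $\mathcal{A}$, the tight upper bound $b=\inf\{k\in\mathbb{R}\mid \mathcal{A}\text{ has no }k\text{-covering run}\}$ (which is a nonnegative integer) can be computed in polynomial time.
   Context: A 0-C1PVASS is a tuple $\mathcal{A}=(S,\Gamma,\delta,\bot,s_0,f)$: finite state set $S$, finite stack alphabet $\Gamma\ni\bot$, initial state $s_0$, accepting state $f$, and a partial function $\delta:S\times S\rightharpoonup\mathbb{Z}\times(\{a,\overline{a}\mid a\in\Gamma\setminus\{\bot\}\}\cup\{\epsilon\})$ giving a counter update (integer, encoded in binary) and a stack operation (push $a$, pop $a$, or none). Configurations are $(s,\alpha,c)$ with $\alpha\in\Gamma^*$ and $c\in\mathbb{R}_{\ge0}$; the initial configuration is $(s_0,\bot,0)$. A run is a sequence of configurations starting in the initial configuration where consecutive states are linked by a defined transition $(z,op)$, the stack is updated according to $op$, and $c_{i+1}=c_i+\gamma_i z$ for some $\gamma_i\in(0,1]$, all counter values being $\ge0$. A run is $k$-covering if it ends in $f$ with counter value $\ge k$. $\mathcal{A}$ is bounded if for some $k\in\mathbb{R}_{\ge0}$ it has no $k$-covering run.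
   Formalization: The infimum defining b is taken over nonnegative k: if no run reaches f, the set over all reals is ℝ with infimum −∞, not a nonnegative integer, and b is then set to 0; otherwise the two infima agree. States and stack symbols are named by natural numbers. *)

theory Defs
  imports
    Complex_Main
    "HOL-Library.Log_Nat"
    "HOL-Computational_Algebra.Polynomial"
begin

section \<open>Continuous one-counter pushdown VASS without zero tests\<close>

datatype 'g stack_op = Push 'g | Pop 'g | NoOp

record ('s, 'g) pvass =
  states :: "'s set"
  stack_alphabet :: "'g set"
  trans :: "'s \<times> 's \<rightharpoonup> int \<times> 'g stack_op"
  bottom :: 'g
  init_state :: 's
  acc_state :: 's

fun op_symbols :: "'g stack_op \<Rightarrow> 'g set" where
  "op_symbols (Push a) = {a}"
| "op_symbols (Pop a) = {a}"
| "op_symbols NoOp = {}"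

definition is_pvass :: "('s, 'g) pvass \<Rightarrow> bool" where
  "is_pvass A \<longleftrightarrow>
     finite (states A) \<and> finite (stack_alphabet A) \<and>
     bottom A \<in> stack_alphabet A \<and>
     init_state A \<in> states A \<and> acc_state A \<in> states A \<and>
     dom (trans A) \<subseteq> states A \<times> states A \<and>
     (\<forall>z opr. (z, opr) \<in> ran (trans A) \<longrightarrow> op_symbols opr \<subseteq> stack_alphabet A - {bottom A})"

type_synonym ('s, 'g) config = "'s \<times> 'g list \<times> real"

definition configs :: "('s, 'g) pvass \<Rightarrow> ('s, 'g) config set" where
  "configs A = states A \<times> lists (stack_alphabet A) \<times> {0..}"

definition init_config :: "('s, 'g) pvass \<Rightarrow> ('s, 'g) config" where
  "init_config A = (init_state A, [bottom A], 0)"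

text \<open>The top of the stack is the head of the list.\<close>

fun stack_step :: "'g stack_op \<Rightarrow> 'g list \<Rightarrow> 'g list \<Rightarrow> bool" where
  "stack_step (Push a) \<alpha> \<beta> \<longleftrightarrow> \<beta> = a # \<alpha>"
| "stack_step (Pop a) \<alpha> \<beta> \<longleftrightarrow> \<alpha> = a # \<beta>"
| "stack_step NoOp \<alpha> \<beta> \<longleftrightarrow> \<beta> = \<alpha>"

fun config_step :: "('s, 'g) pvass \<Rightarrow> ('s, 'g) config \<Rightarrow> ('s, 'g) config \<Rightarrow> bool" where
  "config_step A (s, \<alpha>, c) (s', \<alpha>', c') \<longleftrightarrow>
     (\<exists>z opr. trans A (s, s') = Some (z, opr) \<and> stack_step opr \<alpha> \<alpha>' \<and>
       (\<exists>\<gamma>::real. 0 < \<gamma> \<and> \<gamma> \<le> 1 \<and> c' = c + \<gamma> * of_int z))"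

definition is_run :: "('s, 'g) pvass \<Rightarrow> ('s, 'g) config list \<Rightarrow> bool" where
  "is_run A \<rho> \<longleftrightarrow>
     \<rho> \<noteq> [] \<and> hd \<rho> = init_config A \<and> set \<rho> \<subseteq> configs A \<and>
     (\<forall>i. Suc i < length \<rho> \<longrightarrow> config_step A (\<rho> ! i) (\<rho> ! Suc i))"

definition covering_run :: "('s, 'g) pvass \<Rightarrow> real \<Rightarrow> ('s, 'g) config list \<Rightarrow> bool" where
  "covering_run A k \<rho> \<longleftrightarrow>
     is_run A \<rho> \<and> (\<exists>\<alpha> c. last \<rho> = (acc_state A, \<alpha>, c) \<and> k \<le> c)"

definition bounded_pvass :: "('s, 'g) pvass \<Rightarrow> bool" where
  "bounded_pvass A \<longleftrightarrow> (\<exists>k\<ge>0. \<not> (\<exists>\<rho>. covering_run A k \<rho>))"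

text \<open>
  The infimum is over nonnegative thresholds, as in the definition of boundedness. This only
  matters if no run reaches the accepting state: then there is no covering run for any real
  number, and the infimum over all reals would not exist. Otherwise both infima agree, see the
  lemma below.
\<close>

definition tight_bound :: "('s, 'g) pvass \<Rightarrow> real" where
  "tight_bound A = Inf {k. 0 \<le> k \<and> \<not> (\<exists>\<rho>. covering_run A k \<rho>)}"

lemma tight_bound_eq_Inf_reals:
  assumes "covering_run A k\<^sub>0 \<rho>\<^sub>0"
  shows "tight_bound A = Inf {k. \<not> (\<exists>\<rho>. covering_run A k \<rho>)}"
proof -
  obtain \<alpha> c where last: "last \<rho>\<^sub>0 = (acc_state A, \<alpha>, c)" and run: "is_run A \<rho>\<^sub>0"
    using assms by (auto simp: covering_run_def)
  have "last \<rho>\<^sub>0 \<in> configs A"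
    using run last_in_set[of \<rho>\<^sub>0] by (auto simp: is_run_def)
  then have "0 \<le> c"
    using last by (auto simp: configs_def)
  then have "covering_run A k \<rho>\<^sub>0" if "k < 0" for k
    using that run last by (auto simp: covering_run_def)
  then have "{k. 0 \<le> k \<and> \<not> (\<exists>\<rho>. covering_run A k \<rho>)} = {k. \<not> (\<exists>\<rho>. covering_run A k \<rho>)}"
    by (auto simp: not_less[symmetric])
  then show ?thesis
    by (simp add: tight_bound_def)
qed


section \<open>Polynomial time\<close>

text \<open>
  The machine model is the random access machine with integer registers, integer input and
  output tapes, and logarithmic cost (Cook and Reckhow; Aho, Hopcroft and Ullman), which is
  polynomially equivalent to multitape Turing machines working on binary representations: every
  operation costs the number of bits of the integers it handles, including the registers' contents
  that serve as addresses.
\<close>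

definition bit_size :: "int \<Rightarrow> nat" where
  "bit_size x = max 1 (floorlog 2 (nat \<bar>x\<bar>))"

datatype instr =
    Const nat int      \<comment> \<open>\<open>X\<^sub>i := c\<close>\<close>
  | Add nat nat nat    \<comment> \<open>\<open>X\<^sub>i := X\<^sub>j + X\<^sub>k\<close>\<close>
  | Sub nat nat nat    \<comment> \<open>\<open>X\<^sub>i := X\<^sub>j - X\<^sub>k\<close>\<close>
  | Mult nat nat nat   \<comment> \<open>\<open>X\<^sub>i := X\<^sub>j * X\<^sub>k\<close>\<close>
  | Load nat nat       \<comment> \<open>\<open>X\<^sub>i := X[X\<^sub>j]\<close>\<close>
  | Store nat nat      \<comment> \<open>\<open>X[X\<^sub>i] := X\<^sub>j\<close>\<close>
  | Read nat           \<comment> \<open>next input integer to \<open>X\<^sub>i\<close>\<close>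
  | Write nat          \<comment> \<open>\<open>X\<^sub>i\<close> to the output\<close>
  | Jump nat
  | JumpPos nat nat    \<comment> \<open>jump to \<open>l\<close> if \<open>X\<^sub>j > 0\<close>\<close>

type_synonym ram = "instr list"

text \<open>Program counter, registers, unread input, output written so far.\<close>
type_synonym ram_config = "nat \<times> (nat \<Rightarrow> int) \<times> int list \<times> int list"

text \<open>
  Cost and successor configuration. Indirect access to a negative address and reading past the
  end of the input are errors, in which the machine gets stuck without having halted.
\<close>

fun exec_instr :: "instr \<Rightarrow> ram_config \<Rightarrow> (nat \<times> ram_config) option" where
  "exec_instr (Const i c) (pc, X, inp, out) =
     Some (bit_size c, (Suc pc, X(i := c), inp, out))"
| "exec_instr (Add i j k) (pc, X, inp, out) =
     Some (bit_size (X j) + bit_size (X k), (Suc pc, X(i := X j + X k), inp, out))"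
| "exec_instr (Sub i j k) (pc, X, inp, out) =
     Some (bit_size (X j) + bit_size (X k), (Suc pc, X(i := X j - X k), inp, out))"
| "exec_instr (Mult i j k) (pc, X, inp, out) =
     Some (bit_size (X j) + bit_size (X k), (Suc pc, X(i := X j * X k), inp, out))"
| "exec_instr (Load i j) (pc, X, inp, out) =
     (if X j < 0 then None
      else Some (bit_size (X j) + bit_size (X (nat (X j))),
                 (Suc pc, X(i := X (nat (X j))), inp, out)))"
| "exec_instr (Store i j) (pc, X, inp, out) =
     (if X i < 0 then None
      else Some (bit_size (X i) + bit_size (X j), (Suc pc, X(nat (X i) := X j), inp, out)))"
| "exec_instr (Read i) (pc, X, inp, out) =
     (case inp of
        [] \<Rightarrow> None
      | x # inp' \<Rightarrow> Some (bit_size x, (Suc pc, X(i := x), inp', out)))"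
| "exec_instr (Write i) (pc, X, inp, out) =
     Some (bit_size (X i), (Suc pc, X, inp, out @ [X i]))"
| "exec_instr (Jump l) (pc, X, inp, out) =
     Some (1, (l, X, inp, out))"
| "exec_instr (JumpPos j l) (pc, X, inp, out) =
     Some (bit_size (X j), (if X j > 0 then l else Suc pc, X, inp, out))"

text \<open>Reachability between configurations, with the accumulated cost.\<close>

inductive ram_steps :: "ram \<Rightarrow> ram_config \<Rightarrow> nat \<Rightarrow> ram_config \<Rightarrow> bool" for P where
  refl: "ram_steps P c 0 c"
| step: "\<lbrakk>fst c < length P; exec_instr (P ! fst c) c = Some (t, c'); ram_steps P c' u c''\<rbrakk>
         \<Longrightarrow> ram_steps P c (t + u) c''"

text \<open>The machine halts when the program counter leaves the program.\<close>

definition ram_outputs :: "ram \<Rightarrow> int list \<Rightarrow> int list \<Rightarrow> nat \<Rightarrow> bool" where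
  "ram_outputs P xs ys t \<longleftrightarrow>
     (\<exists>pc X rest. ram_steps P (0, (\<lambda>_. 0), xs, []) t (pc, X, rest, ys) \<and> length P \<le> pc)"

definition input_size :: "int list \<Rightarrow> nat" where
  "input_size xs = sum_list (map bit_size xs)"

definition poly_time_computable_on ::
    "'a set \<Rightarrow> ('a \<Rightarrow> int list) \<Rightarrow> ('a \<Rightarrow> int list) \<Rightarrow> bool" where
  "poly_time_computable_on D enc f \<longleftrightarrow>
     (\<exists>(P::ram) (p::nat poly). \<forall>x\<in>D. \<exists>t\<le>poly p (input_size (enc x)).
        ram_outputs P (enc x) (f x) t)"


section \<open>Encoding of instances\<close>

text \<open>
  States and stack symbols are named by natural numbers. An instance is written as the list of
  its states, the list of its stack symbols, the three distinguished elements, and the list of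
  its transitions, each list preceded by its length. Names and counter updates thus count with
  their binary length.
\<close>

fun encode_op :: "nat stack_op \<Rightarrow> int list" where
  "encode_op NoOp = [0, 0]"
| "encode_op (Push a) = [1, int a]"
| "encode_op (Pop a) = [2, int a]"

definition transition_list :: "(nat, nat) pvass \<Rightarrow> (nat \<times> nat \<times> int \<times> nat stack_op) list" where
  "transition_list A =
     (let ss = sorted_list_of_set (states A)
      in [(s, s', the (trans A (s, s'))). s \<leftarrow> ss, s' \<leftarrow> ss, (s, s') \<in> dom (trans A)])"

definition encode_pvass :: "(nat, nat) pvass \<Rightarrow> int list" where
  "encode_pvass A =
     (let ss = sorted_list_of_set (states A);
          gs = sorted_list_of_set (stack_alphabet A);
          ts = transition_list A
      in int (length ss) # map int ss @
         int (length gs) # map int gs @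
         [int (bottom A), int (init_state A), int (acc_state A)] @
         int (length ts) #
         concat (map (\<lambda>(s, s', z, opr). [int s, int s', z] @ encode_op opr) ts))"

end

theory Submission
  imports Defs
begin

text \<open>
  Decrements can be scaled down to almost nothing and increments taken in full, so the supremum of
  the counter over the runs along a stack-consistent path is the sum of its positive updates, provided
  that the first nonzero update is positive; a phase bit in the states takes care of this condition.
  The bound is thus the maximal weight of a path in a pushdown system, equivalently of a derivation in
  a weighted context-free grammar whose nonterminals are pairs of nodes. If the weights are bounded,
  pumping a repeated nonterminal cannot add weight, and a derivation of maximal weight and minimal size
  has at most as many levels as there are nonterminals. Polynomially many rounds of relaxation of
  the grammar rules therefore compute the bound; cells whose weights are unbounded may still grow,
  but each relaxation adds only a constant number of bits.
\<close>

section \<open>Derivations of maximal weight\<close>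

text \<open>Boundedness speaks about the goal alone: it bounds the weights of the single cell
  (\<open>start_node A\<close>, 0), while other cells may have derivations of every weight. This
  shapes the argument in two ways. Pumping has to take place inside a complete derivation of that
  cell: a second copy of a loop shows that the loop weighs 0, and cutting it out then contradicts
  minimal size. And the algorithm cannot wait for a fixpoint; the number of rounds is fixed by the
  number of cells, and the goal cell is squeezed from two sides. At all times it records the weight
  of some derivation, and after h rounds it dominates every derivation of height at most h. A
  decrement always costs a positive amount, so a path weight is in general a supremum that no run
  attains, and a counter equal to 0 cannot be decremented at all; the latter is the origin of the
  phase bit. Sums may double at each relaxation, so the cost analysis counts bits. Repeated squaring
  would destroy it, hence products occur only for addresses and for the number of rounds.\<close>

inductive tree :: "'c set \<Rightarrow> ('c \<times> 'c \<times> 'c \<times> int) set \<Rightarrow> 'c \<Rightarrow> int \<Rightarrow> nat \<Rightarrow> bool"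
  for Ax R where
  ax: "x \<in> Ax \<Longrightarrow> tree Ax R x 0 1"
| rl: "\<lbrakk>(x, y, z, k) \<in> R; tree Ax R y w1 n1; tree Ax R z w2 n2\<rbrakk>
       \<Longrightarrow> tree Ax R x (w1 + w2 + k) (Suc (n1 + n2))"

inductive tree_height :: "'c set \<Rightarrow> ('c \<times> 'c \<times> 'c \<times> int) set \<Rightarrow> nat \<Rightarrow> 'c \<Rightarrow> int \<Rightarrow> bool"
  for Ax R where
  ax: "x \<in> Ax \<Longrightarrow> tree_height Ax R (Suc h) x 0"
| rl: "\<lbrakk>(x, y, z, k) \<in> R; tree_height Ax R h y w1; tree_height Ax R h z w2\<rbrakk>
       \<Longrightarrow> tree_height Ax R (Suc h) x (w1 + w2 + k)"

text \<open>\<open>tree_ctx Ax R x y c n\<close>: a tree for \<open>x\<close> of weight \<open>c\<close> and size \<open>n\<close> with a hole for a tree for \<open>y\<close>.\<close>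
inductive tree_ctx :: "'c set \<Rightarrow> ('c \<times> 'c \<times> 'c \<times> int) set \<Rightarrow> 'c \<Rightarrow> 'c \<Rightarrow> int \<Rightarrow> nat \<Rightarrow> bool"
  for Ax R x0 where
  hole: "tree_ctx Ax R x0 x0 0 0"
| left: "\<lbrakk>tree_ctx Ax R x0 x c n; (x, y, z, k) \<in> R; tree Ax R z w n'\<rbrakk>
       \<Longrightarrow> tree_ctx Ax R x0 y (c + w + k) (Suc (n + n'))"
| right: "\<lbrakk>tree_ctx Ax R x0 x c n; (x, y, z, k) \<in> R; tree Ax R y w n'\<rbrakk>
       \<Longrightarrow> tree_ctx Ax R x0 z (c + w + k) (Suc (n + n'))"

lemma tree_ctx_plug:
  "tree_ctx Ax R x0 x c n \<Longrightarrow> tree Ax R x w s \<Longrightarrow> tree Ax R x0 (c + w) (n + s)"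
proof (induction arbitrary: w s rule: tree_ctx.induct)
  case hole
  then show ?case by simp
next
  case (left x c n y z k w' n')
  from left.IH[OF tree.rl[OF left.hyps(2) left.prems left.hyps(3)]]
  show ?case by (simp add: algebra_simps)
next
  case (right x c n y z k w' n')
  from right.IH[OF tree.rl[OF right.hyps(2,3) right.prems]]
  show ?case by (simp add: algebra_simps)
qed

lemma tree_weight_nonneg:
  assumes "\<And>x y z k. (x, y, z, k) \<in> R \<Longrightarrow> 0 \<le> k"
  shows "tree Ax R x w n \<Longrightarrow> 0 \<le> w"
  by (induction rule: tree.induct) (auto dest: assms)

lemma tree_ctx_weight_nonneg:
  assumes "\<And>x y z k. (x, y, z, k) \<in> R \<Longrightarrow> 0 \<le> k"
  shows "tree_ctx Ax R x y w n \<Longrightarrow> 0 \<le> w"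
proof (induction rule: tree_ctx.induct)
  case (left x c n y z k w n')
  then show ?case using assms tree_weight_nonneg[OF assms left.hyps(3)] by (meson add_nonneg_nonneg)
next
  case (right x c n y z k w n')
  then show ?case using assms tree_weight_nonneg[OF assms right.hyps(3)] by (meson add_nonneg_nonneg)
qed simp

text \<open>\<open>L\<close> collects the nonterminals on the branch from the root \<open>x0\<close>
  down to the hole, each witnessed by a splitting of the surrounding context. Plugging the current
  tree into that context always gives weight \<open>wm\<close> and size \<open>sm\<close>. A member
  of \<open>L\<close> cannot recur below, so every level enlarges \<open>L\<close> inside
  \<open>C\<close>, and \<open>h\<close> bounds the number of nonterminals that remain.\<close>

lemma tree_height_of_optimal_tree:
  fixes R :: "('c \<times> 'c \<times> 'c \<times> int) set"
  assumes nonneg: "\<And>x y z k. (x, y, z, k) \<in> R \<Longrightarrow> 0 \<le> k"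
    and C: "finite C" "Ax \<subseteq> C" "fst ` R \<subseteq> C"
    and max: "\<And>w s. tree Ax R x0 w s \<Longrightarrow> w \<le> wm"
    and min: "\<And>s. tree Ax R x0 wm s \<Longrightarrow> sm \<le> s"
  shows "tree Ax R x w s \<Longrightarrow> tree_ctx Ax R x0 x c n \<Longrightarrow> c + w = wm \<Longrightarrow> n + s = sm \<Longrightarrow>
    (\<And>y. y \<in> L \<Longrightarrow> \<exists>c1 n1 c2 n2. tree_ctx Ax R x0 y c1 n1 \<and> tree_ctx Ax R y x c2 n2 \<and>
        0 < n2 \<and> c1 + c2 = c \<and> n1 + n2 = n) \<Longrightarrow>
    L \<subseteq> C \<Longrightarrow> card C \<le> h + card L \<Longrightarrow> tree_height Ax R h x w"
proof (induction arbitrary: c n L h rule: tree.induct)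
  have fresh: "x \<notin> L" if hyps: "tree Ax R x w s" "c + w = wm" "n + s = sm"
    "\<And>y. y \<in> L \<Longrightarrow> \<exists>c1 n1 c2 n2. tree_ctx Ax R x0 y c1 n1 \<and> tree_ctx Ax R y x c2 n2 \<and>
        0 < n2 \<and> c1 + c2 = c \<and> n1 + n2 = n" for x w s c n L
  proof
    assume "x \<in> L"
    then obtain c1 n1 c2 n2 where *: "tree_ctx Ax R x0 x c1 n1" "tree_ctx Ax R x x c2 n2"
      "0 < n2" "c1 + c2 = c" "n1 + n2 = n" using hyps(4) by blast
    have t1: "tree Ax R x0 (c1 + w) (n1 + s)" using tree_ctx_plug[OF *(1) hyps(1)] .
    \<comment> \<open>The loop at \<open>x\<close> is taken twice: the weight becomes
      \<open>wm + c2\<close>, so maximality gives \<open>c2 \<le> 0\<close>.\<close>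
    have t2: "tree Ax R x0 (c1 + (c2 + (c2 + w))) (n1 + (n2 + (n2 + s)))"
      using tree_ctx_plug[OF *(1) tree_ctx_plug[OF *(2) tree_ctx_plug[OF *(2) hyps(1)]]] .
    have "0 \<le> c2" using tree_ctx_weight_nonneg[OF nonneg *(2)] .
    moreover have "c2 \<le> 0" using max[OF t2] *(4) hyps(2) by simp
    ultimately have "c1 + w = wm" using *(4) hyps(2) by simp
    \<comment> \<open>Without the loop the tree still weighs \<open>wm\<close>, but its size has
      dropped by \<open>n2 > 0\<close>.\<close>
    then show False using min[of "n1 + s"] t1 *(3,5) hyps(3) by simp
  qed
  {
    case (ax x)
    have "x \<notin> L" by (rule fresh[OF tree.ax[OF ax(1)] ax(3,4) ax(5)])
    moreover have "x \<in> C" using ax C by auto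
    ultimately have "card L < card C"
      using ax.prems(5) C(1) by (metis psubsetI psubset_card_mono)
    then obtain h' where "h = Suc h'" using ax.prems by (cases h) auto
    then show ?case using ax by (auto intro: tree_height.ax)
  next
    case (rl x y z k w1 n1 w2 n2)
    have tx: "tree Ax R x (w1 + w2 + k) (Suc (n1 + n2))" using rl.hyps by (rule tree.rl)
    have xL: "x \<notin> L" by (rule fresh[OF tx rl.prems(2,3,4)])
    have xC: "x \<in> C" using rl.hyps C by force
    have "card L < card C"
      using rl.prems(5) xL xC C(1) by (metis psubsetI psubset_card_mono)
    then obtain h' where h: "h = Suc h'" using rl.prems by (cases h) auto
    have fL: "finite L" using rl.prems(5) C(1) by (rule finite_subset)
    have sub: "insert x L \<subseteq> C" using xC rl.prems(5) by simp
    have card: "card C \<le> h' + card (insert x L)" using xL fL rl.prems(6) h by simp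
    have "tree_height Ax R h' y w1"
    proof (rule rl.IH(1)[OF _ _ _ _ sub card])
      show "tree_ctx Ax R x0 y (c + w2 + k) (Suc (n + n2))"
        using rl.prems(1) rl.hyps by (blast intro: tree_ctx.left)
      show "(c + w2 + k) + w1 = wm" "Suc (n + n2) + n1 = sm" using rl.prems by auto
      fix a assume "a \<in> insert x L"
      then obtain c1 m1 c2 m2 where a: "tree_ctx Ax R x0 a c1 m1" "tree_ctx Ax R a x c2 m2"
        "c1 + c2 = c" "m1 + m2 = n"
        using rl.prems(1,4) tree_ctx.hole
        by (metis add.right_neutral insertE)
      then show "\<exists>c1 n1 c2 n2'. tree_ctx Ax R x0 a c1 n1 \<and> tree_ctx Ax R a y c2 n2' \<and>
          0 < n2' \<and> c1 + c2 = c + w2 + k \<and> n1 + n2' = Suc (n + n2)"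
        using tree_ctx.left[OF a(2) rl.hyps(1,3)]
        by (intro exI[of _ c1] exI[of _ m1] exI[of _ "c2 + w2 + k"] exI[of _ "Suc (m2 + n2)"]) simp
    qed
    moreover have "tree_height Ax R h' z w2"
    proof (rule rl.IH(2)[OF _ _ _ _ sub card])
      show "tree_ctx Ax R x0 z (c + w1 + k) (Suc (n + n1))"
        using rl.prems(1) rl.hyps by (blast intro: tree_ctx.right)
      show "(c + w1 + k) + w2 = wm" "Suc (n + n1) + n2 = sm" using rl.prems by auto
      fix a assume "a \<in> insert x L"
      then obtain c1 m1 c2 m2 where a: "tree_ctx Ax R x0 a c1 m1" "tree_ctx Ax R a x c2 m2"
        "c1 + c2 = c" "m1 + m2 = n"
        using rl.prems(1,4) tree_ctx.hole
        by (metis add.right_neutral insertE)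
      then show "\<exists>c1 n1' c2 n2. tree_ctx Ax R x0 a c1 n1' \<and> tree_ctx Ax R a z c2 n2 \<and>
          0 < n2 \<and> c1 + c2 = c + w1 + k \<and> n1' + n2 = Suc (n + n1)"
        using tree_ctx.right[OF a(2) rl.hyps(1,2)]
        by (intro exI[of _ c1] exI[of _ m1] exI[of _ "c2 + w1 + k"] exI[of _ "Suc (m2 + n1)"]) simp
    qed
    ultimately show ?case using rl.hyps(1) h by (auto intro: tree_height.rl)
  }
qed

lemma max_weight_tree_height:
  fixes R :: "('c \<times> 'c \<times> 'c \<times> int) set"
  assumes nonneg: "\<And>x y z k. (x, y, z, k) \<in> R \<Longrightarrow> 0 \<le> k"
    and C: "finite C" "Ax \<subseteq> C" "fst ` R \<subseteq> C" "card C \<le> h"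
    and max: "\<And>w s. tree Ax R x w s \<Longrightarrow> w \<le> wm"
    and attained: "tree Ax R x wm s"
  shows "tree_height Ax R h x wm"
proof -
  define sm where "sm = (LEAST s. tree Ax R x wm s)"
  have "tree Ax R x wm sm" unfolding sm_def using attained by (rule LeastI)
  moreover have "sm \<le> s" if "tree Ax R x wm s" for s unfolding sm_def using that by (rule Least_le)
  ultimately show ?thesis
    by (intro tree_height_of_optimal_tree[where C = C and x0 = x and wm = wm and sm = sm and s = sm and c = 0
          and n = 0 and L = "{}"]) (use nonneg C max in \<open>auto intro: tree_ctx.hole\<close>)
qed

section \<open>In-place relaxation of cells and its monotonicity\<close>

definition relax :: "'c \<Rightarrow> 'c \<Rightarrow> 'c \<Rightarrow> int \<Rightarrow> ('c \<Rightarrow> int) \<Rightarrow> 'c \<Rightarrow> int" where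
  "relax x y z k V = (if 0 < V y \<and> 0 < V z \<and> V x < V y + V z + k - 1
     then V(x := V y + V z + k - 1) else V)"

definition init_cell :: "'c \<Rightarrow> ('c \<Rightarrow> int) \<Rightarrow> 'c \<Rightarrow> int" where
  "init_cell x V = (if 0 < V x then V else V(x := 1))"

text \<open>Cells hold the weight plus one; zero stands for an underivable cell.\<close>
definition sound_cells :: "'c set \<Rightarrow> ('c \<times> 'c \<times> 'c \<times> int) set \<Rightarrow> ('c \<Rightarrow> int) \<Rightarrow> bool" where
  "sound_cells Ax R V \<longleftrightarrow> (\<forall>x. 0 \<le> V x \<and> (0 < V x \<longrightarrow> (\<exists>s. tree Ax R x (V x - 1) s)))"

text \<open>Adding two cells counts the encoding offset twice, hence the \<open>- 1\<close> in
  \<open>relax\<close>: the subtrees weigh \<open>V y - 1\<close> and \<open>V z - 1\<close>, and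
  the new tree weighs one less than the new entry.\<close>

lemma sound_relax:
  assumes "sound_cells Ax R V" "(x, y, z, k) \<in> R"
  shows "sound_cells Ax R (relax x y z k V)"
proof (cases "0 < V y \<and> 0 < V z \<and> V x < V y + V z + k - 1")
  case True
  then obtain s1 s2 where "tree Ax R y (V y - 1) s1" "tree Ax R z (V z - 1) s2"
    using assms unfolding sound_cells_def by blast
  from tree.rl[OF assms(2) this] have "tree Ax R x (V y + V z + k - 2) (Suc (s1 + s2))"
    by (simp add: algebra_simps)
  then show ?thesis using True assms(1) unfolding relax_def sound_cells_def
    by (smt (verit, best) fun_upd_apply)
next
  case False
  then show ?thesis using assms by (auto simp: relax_def)
qed

lemma sound_init_cell:
  assumes "sound_cells Ax R V" "x \<in> Ax"
  shows "sound_cells Ax R (init_cell x V)"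
  using assms tree.ax[OF assms(2), of R] unfolding sound_cells_def init_cell_def by auto

lemma le_relax: "V \<le> relax x y z k V"
  by (auto simp: relax_def le_fun_def)

lemma le_init_cell: "V \<le> init_cell x V"
  by (auto simp: init_cell_def le_fun_def)

lemma le_fold:
  assumes "\<And>a V. a \<in> set xs \<Longrightarrow> (V :: 'b :: preorder) \<le> f a V"
  shows "V \<le> fold f xs V"
  using assms
proof (induction xs arbitrary: V)
  case (Cons a xs)
  have "V \<le> f a V" using Cons.prems by simp
  also have "\<dots> \<le> fold f xs (f a V)" using Cons by simp
  finally show ?case by simp
qed simp

text \<open>Every step of a sweep only raises \<open>V\<close>. Hence the state in which
  \<open>a\<close> is processed still lies above \<open>V0\<close>, and what that step achieves
  survives the rest of the sweep. In this way in-place updates are compared with the state at the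
  start of a round.\<close>

lemma fold_reaches:
  fixes V V0 :: "'b :: preorder"
  assumes "\<And>a V. V \<le> f a V" "a \<in> set xs" "V0 \<le> V"
    "\<And>V. V0 \<le> V \<Longrightarrow> Q (f a V)" "\<And>V V'. Q V \<Longrightarrow> V \<le> V' \<Longrightarrow> Q V'"
  shows "Q (fold f xs V)"
proof -
  obtain ys zs where xs: "xs = ys @ a # zs" using assms(2) by (meson split_list)
  have "V0 \<le> fold f ys V" using assms(1,3) le_fold[of ys f V] order_trans by blast
  then have "Q (f a (fold f ys V))" by (rule assms(4))
  moreover have "f a (fold f ys V) \<le> fold f zs (f a (fold f ys V))" using assms(1) by (intro le_fold) auto
  ultimately show ?thesis using assms(5) xs by auto
qed

lemma fold_preserves:
  assumes "\<And>a V. a \<in> set xs \<Longrightarrow> P V \<Longrightarrow> P (f a V)" "P V"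
  shows "P (fold f xs V)"
  using assms by (induction xs arbitrary: V) auto

section \<open>Runs as weighted paths\<close>

type_synonym edge = "int \<times> int \<times> int \<times> nat stack_op"

text \<open>The phase bit is 1 once the counter has become positive. The number 0 is left free for a sink.\<close>
definition node :: "nat \<Rightarrow> bool \<Rightarrow> int" where
  "node s b = 2 * int s + 1 + of_bool b"

lemma node_inj [simp]: "node s b = node s' b' \<longleftrightarrow> s = s' \<and> b = b'"
  unfolding node_def by (cases b; cases b'; simp; presburger)

lemma node_pos [simp]: "0 < node s b"
  by (auto simp: node_def)

lemma node_neq_0 [simp]: "node s b \<noteq> 0"
  using node_pos[of s b] by linarith

text \<open>For \<open>z > 0\<close> the first edge switches the phase bit on, for
  \<open>z = 0\<close> it stays in phase 0. For \<open>z < 0\<close> a step from counter 0 is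
  impossible because the scaling factor is positive; the first edge then coincides with the second.
  Producing two edges in every case keeps the table built by the program uniform.\<close>

fun edges_of :: "nat \<times> nat \<times> int \<times> nat stack_op \<Rightarrow> edge list" where
  "edges_of (s, s', z, opr) =
     [(node s (z < 0), node s' (z \<noteq> 0), max z 0, opr), (node s True, node s' True, max z 0, opr)]"

definition edges :: "(nat, nat) pvass \<Rightarrow> edge set" where
  "edges A = (\<Union>t \<in> set (transition_list A). set (edges_of t))"

inductive edge_path :: "edge set \<Rightarrow> int \<times> nat list \<Rightarrow> int \<Rightarrow> int \<times> nat list \<Rightarrow> bool" for E c where
  nil: "edge_path E c 0 c"
| snoc: "\<lbrakk>edge_path E c w (p, \<alpha>); (p, q, z, opr) \<in> E; stack_step opr \<alpha> \<beta>\<rbrakk>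
         \<Longrightarrow> edge_path E c (w + z) (q, \<beta>)"

lemma edge_path_trans:
  assumes "edge_path E c1 w1 c2" "edge_path E c2 w2 c3"
  shows "edge_path E c1 (w1 + w2) c3"
  using assms(2)
proof (induction rule: edge_path.induct)
  case nil
  then show ?case using assms(1) by simp
next
  case (snoc w p \<alpha> q z opr \<beta>)
  from edge_path.snoc[OF snoc.IH snoc.hyps(2,3)] show ?case by (simp add: add.assoc)
qed

lemma set_transition_list:
  assumes "is_pvass A"
  shows "(s, s', z, opr) \<in> set (transition_list A) \<longleftrightarrow> trans A (s, s') = Some (z, opr)"
proof -
  have fin: "finite (states A)" and dom: "dom (trans A) \<subseteq> states A \<times> states A"
    using assms by (auto simp: is_pvass_def)
  show ?thesis
    unfolding transition_list_def Let_def
    using fin dom by (force simp: dom_def)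
qed

lemma edges_iff:
  assumes "is_pvass A"
  shows "(p, q, w, opr) \<in> edges A \<longleftrightarrow>
    (\<exists>s s' z. trans A (s, s') = Some (z, opr) \<and> w = max z 0 \<and>
       (p = node s (z < 0) \<and> q = node s' (z \<noteq> 0) \<or> p = node s True \<and> q = node s' True))"
  unfolding edges_def
  by (auto simp: set_transition_list[OF assms, symmetric] Bex_def)

lemma edges_weight_nonneg: "(p, q, w, opr) \<in> edges A \<Longrightarrow> 0 \<le> w"
  by (auto simp: edges_def)

section \<open>Runs of the machine and weighted paths\<close>

lemma is_run_snoc:
  assumes "\<rho> \<noteq> []"
  shows "is_run A (\<rho> @ [x]) \<longleftrightarrow> is_run A \<rho> \<and> x \<in> configs A \<and> config_step A (last \<rho>) x"
proof -
  have "(\<forall>i. Suc i < length (\<rho> @ [x]) \<longrightarrow> config_step A ((\<rho> @ [x]) ! i) ((\<rho> @ [x]) ! Suc i)) \<longleftrightarrow>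
    (\<forall>i. Suc i < length \<rho> \<longrightarrow> config_step A (\<rho> ! i) (\<rho> ! Suc i)) \<and> config_step A (last \<rho>) x"
    (is "?L \<longleftrightarrow> ?R")
  proof
    assume L: ?L
    have "config_step A (\<rho> ! i) (\<rho> ! Suc i)" if "Suc i < length \<rho>" for i
      using L[rule_format, of i] that by (simp add: nth_append)
    moreover have "config_step A (last \<rho>) x"
      using L[rule_format, of "length \<rho> - 1"] assms by (simp add: nth_append last_conv_nth)
    ultimately show ?R by simp
  next
    assume R: ?R
    show ?L
    proof (intro allI impI)
      fix i assume i: "Suc i < length (\<rho> @ [x])"
      show "config_step A ((\<rho> @ [x]) ! i) ((\<rho> @ [x]) ! Suc i)"
      proof (cases "Suc i < length \<rho>")
        case True
        then show ?thesis using R by (simp add: nth_append)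
      next
        case False
        then have "i = length \<rho> - 1" "Suc i = length \<rho>" using i by auto
        then show ?thesis using R assms by (simp add: nth_append last_conv_nth)
      qed
    qed
  qed
  then show ?thesis using assms unfolding is_run_def by auto
qed

lemma is_run_singleton: "is_run A [x] \<longleftrightarrow> x = init_config A \<and> x \<in> configs A"
  by (auto simp: is_run_def)

lemma init_config_in_configs: "is_pvass A \<Longrightarrow> init_config A \<in> configs A"
  by (auto simp: is_pvass_def init_config_def configs_def)

abbreviation start_node :: "(nat, nat) pvass \<Rightarrow> int" where
  "start_node A \<equiv> node (init_state A) False"

abbreviation goal_node :: "(nat, nat) pvass \<Rightarrow> int" where
  "goal_node A \<equiv> node (acc_state A) True"

text \<open>Each step gains at most the positive part of its update, since
  \<open>\<gamma> \<le> 1\<close>. In phase 0 the counter is exactly 0, which is what rules out a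
  decrement there.\<close>

lemma edge_path_of_run:
  assumes A: "is_pvass A"
  shows "is_run A \<rho> \<Longrightarrow> last \<rho> = (s, \<alpha>, c) \<Longrightarrow>
    \<exists>b w. edge_path (edges A) (start_node A, [bottom A]) w (node s b, \<alpha>) \<and> c \<le> w \<and> (\<not> b \<longrightarrow> c = 0)"
proof (induction \<rho> arbitrary: s \<alpha> c rule: rev_induct)
  case Nil
  then show ?case by (simp add: is_run_def)
next
  case (snoc x \<rho>)
  show ?case
  proof (cases "\<rho> = []")
    case True
    then show ?thesis using snoc.prems
      by (intro exI[of _ False] exI[of _ 0])
        (auto simp: is_run_singleton init_config_def intro: edge_path.nil)
  next
    case False
    obtain s' \<alpha>' c' where l: "last \<rho> = (s', \<alpha>', c')" by (cases "last \<rho>")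
    have x: "x = (s, \<alpha>, c)" using snoc.prems by simp
    have run: "is_run A \<rho>" "x \<in> configs A" "config_step A (last \<rho>) x"
      using snoc.prems is_run_snoc[OF False] by blast+
    obtain b w where b: "edge_path (edges A) (start_node A, [bottom A]) w (node s' b, \<alpha>')" "c' \<le> w"
      "\<not> b \<longrightarrow> c' = 0" using snoc.IH[OF run(1) l] by blast
    obtain z opr \<gamma> where st: "trans A (s', s) = Some (z, opr)" "stack_step opr \<alpha>' \<alpha>"
      "0 < \<gamma>" "\<gamma> \<le> 1" "c = c' + \<gamma> * of_int z" using run(3) l x by auto
    have c0: "0 \<le> c" using run(2) x by (auto simp: configs_def)
    have up: "c \<le> c' + max z 0"
    proof (cases "0 \<le> z")
      case True
      then have "\<gamma> * of_int z \<le> 1 * of_int z" using st by (intro mult_right_mono) auto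
      then show ?thesis using st True by simp
    next
      case False
      then have "\<gamma> * of_int z \<le> 0" using st by (simp add: mult_nonneg_nonpos)
      then show ?thesis using st False by simp
    qed
    show ?thesis
    proof (cases b)
      case True
      have "(node s' True, node s True, max z 0, opr) \<in> edges A"
        using edges_iff[OF A] st by blast
      then have "edge_path (edges A) (start_node A, [bottom A]) (w + max z 0) (node s True, \<alpha>)"
        using b(1) True by (intro edge_path.snoc[OF _ _ st(2)]) simp_all
      then show ?thesis
        using up b(2) by (intro exI[of _ True] exI[of _ "w + max z 0"]) auto
    next
      case b0: False
      then have z: "\<not> z < 0" using b(3) st(3,5) c0
        by (smt (verit) mult_pos_neg of_int_less_0_iff)
      have "(node s' False, node s (z \<noteq> 0), max z 0, opr) \<in> edges A"
        unfolding edges_iff[OF A] using st(1) z by (intro exI[of _ s'] exI[of _ s] exI[of _ z]) simp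
      then have "edge_path (edges A) (start_node A, [bottom A]) (w + max z 0) (node s (z \<noteq> 0), \<alpha>)"
        using b(1) b0 by (intro edge_path.snoc[OF _ _ st(2)]) simp_all
      then show ?thesis
        using up b(2,3) b0 st(5) by (intro exI[of _ "z \<noteq> 0"] exI[of _ "w + max z 0"]) auto
    qed
  qed
qed

lemma config_step_in_configs:
  assumes A: "is_pvass A" and c: "(s, \<alpha>, c) \<in> configs A" and t: "trans A (s, s') = Some (z, opr)"
    and "stack_step opr \<alpha> \<beta>" "0 \<le> c'"
  shows "(s', \<beta>, c') \<in> configs A"
proof -
  have "s' \<in> states A" using A t by (auto simp: is_pvass_def)
  moreover have "op_symbols opr \<subseteq> stack_alphabet A"
    using A t unfolding is_pvass_def by (blast intro: ranI)
  then have "\<beta> \<in> lists (stack_alphabet A)"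
    using c assms(4) by (cases opr) (auto simp: configs_def)
  ultimately show ?thesis using assms(5) by (simp add: configs_def)
qed

text \<open>In phase 1 only values below \<open>w\<close> are promised, since a decrement always
  costs something; positivity is carried along because the next decrement has to start from a
  positive counter. The quantification over \<open>x\<close> inside the induction lets each step
  choose its prefix run according to the target at hand.\<close>

lemma run_of_edge_path:
  assumes A: "is_pvass A" and path: "edge_path (edges A) (start_node A, [bottom A]) w (p, \<alpha>)"
  shows "\<exists>s b. p = node s b \<and>
     (\<not> b \<longrightarrow> w = 0 \<and> (\<exists>\<rho>. is_run A \<rho> \<and> last \<rho> = (s, \<alpha>, 0))) \<and>
     (b \<longrightarrow> 0 < w \<and> (\<forall>x<of_int w. \<exists>\<rho> c. is_run A \<rho> \<and> last \<rho> = (s, \<alpha>, c) \<and> 0 < c \<and> x < c))"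
proof -
  have "case x of (p, \<alpha>) \<Rightarrow> \<exists>s b. p = node s b \<and>
     (\<not> b \<longrightarrow> w = 0 \<and> (\<exists>\<rho>. is_run A \<rho> \<and> last \<rho> = (s, \<alpha>, 0))) \<and>
     (b \<longrightarrow> 0 < w \<and> (\<forall>x<of_int w. \<exists>\<rho> c. is_run A \<rho> \<and> last \<rho> = (s, \<alpha>, c) \<and> 0 < c \<and> x < c))"
    if "edge_path (edges A) (start_node A, [bottom A]) w x" for w x
  using that
proof (induction rule: edge_path.induct)
  case nil
  have "is_run A [init_config A]"
    using init_config_in_configs[OF A] by (simp add: is_run_singleton)
  then show ?case
    by (auto intro!: exI[of _ "init_state A"] exI[of _ False] exI[of _ "[init_config A]"] simp: init_config_def)
next
  case (snoc w p \<alpha> q k opr \<beta>)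
  from snoc.IH obtain s b where p: "p = node s b"
    and b0: "\<not> b \<Longrightarrow> w = 0 \<and> (\<exists>\<rho>. is_run A \<rho> \<and> last \<rho> = (s, \<alpha>, 0))"
    and b1: "b \<Longrightarrow> 0 < w \<and> (\<forall>x<of_int w. \<exists>\<rho> c. is_run A \<rho> \<and> last \<rho> = (s, \<alpha>, c) \<and> 0 < c \<and> x < c)"
    by blast
  from snoc.hyps(2) edges_iff[OF A] obtain s1 s' z where
    z: "trans A (s1, s') = Some (z, opr)" "k = max z 0"
      "p = node s1 (z < 0) \<and> q = node s' (z \<noteq> 0) \<or> p = node s1 True \<and> q = node s' True" by blast
  then have s1: "s1 = s" using p by auto
  have extend: "\<exists>\<rho>'. is_run A \<rho>' \<and> last \<rho>' = (s', \<beta>, c')"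
    if \<rho>: "is_run A \<rho>" "last \<rho> = (s, \<alpha>, c)" and c': "c' = c + \<gamma> * of_int z" "0 \<le> c'" "0 < \<gamma>" "\<gamma> \<le> 1"
    for \<rho> c c' and \<gamma> :: real
  proof -
    have ne: "\<rho> \<noteq> []" using \<rho> by (auto simp: is_run_def)
    then have "last \<rho> \<in> configs A" using \<rho>(1) by (auto simp: is_run_def)
    then have "(s', \<beta>, c') \<in> configs A"
      using config_step_in_configs[OF A _ z(1)[unfolded s1] snoc.hyps(3) c'(2)] \<rho>(2) by auto
    moreover have "config_step A (last \<rho>) (s', \<beta>, c')"
      using z(1) s1 snoc.hyps(3) \<rho>(2) c' by auto
    ultimately have "is_run A (\<rho> @ [(s', \<beta>, c')])" using is_run_snoc[OF ne] \<rho>(1) by blast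
    then show ?thesis by (intro exI[of _ "\<rho> @ [(s', \<beta>, c')]"]) simp
  qed
  have "\<exists>s b. q = node s b \<and>
     (\<not> b \<longrightarrow> w + k = 0 \<and> (\<exists>\<rho>. is_run A \<rho> \<and> last \<rho> = (s, \<beta>, 0))) \<and>
     (b \<longrightarrow> 0 < w + k \<and> (\<forall>x<of_int (w + k). \<exists>\<rho> c. is_run A \<rho> \<and> last \<rho> = (s, \<beta>, c) \<and> 0 < c \<and> x < c))"
  proof (cases b)
    case True
    then have q: "q = node s' True" using z(3) p by auto
    have "\<exists>\<rho> c. is_run A \<rho> \<and> last \<rho> = (s', \<beta>, c) \<and> 0 < c \<and> x < c" if x: "x < of_int (w + k)" for x
    proof (cases "0 \<le> z")
      case True
      have "x - z < of_int w" using x z(2) True by simp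
      then obtain \<rho> c where "is_run A \<rho>" "last \<rho> = (s, \<alpha>, c)" "0 < c" "x - z < c"
        using b1[OF \<open>b\<close>] by blast
      moreover from this have "0 < c + z" "x < c + z" using True by linarith+
      ultimately show ?thesis using extend[of \<rho> c "c + z" 1] by auto
    next
      case False
      then have "x < of_int w" using x z(2) by simp
      then obtain \<rho> c where r: "is_run A \<rho>" "last \<rho> = (s, \<alpha>, c)" "0 < c" "x < c"
        using b1[OF \<open>b\<close>] by blast
      \<comment> \<open>The decrement consumes at most half of the margin of \<open>c\<close> above
        \<open>max 0 x\<close>, so the new counter exceeds both 0 and \<open>x\<close>.\<close>
      define \<gamma> where "\<gamma> = min 1 ((c - max 0 x) / (2 * - of_int z))"
      have zn: "(of_int z :: real) < 0" using False by simp
      have g: "0 < \<gamma>" "\<gamma> \<le> 1" using r False unfolding \<gamma>_def by (auto simp: divide_pos_neg zero_less_divide_iff)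
      have "\<gamma> * (2 * - of_int z) \<le> c - max 0 x"
        using zn unfolding \<gamma>_def by (simp add: min_def pos_le_divide_eq[symmetric] field_simps)
      then have "max 0 x < c + \<gamma> * of_int z" using r(3,4) by (simp add: algebra_simps) 
      then show ?thesis using extend[OF r(1,2), of "c + \<gamma> * of_int z" \<gamma>] g by force
    qed
    moreover have "0 < w + k" using b1[OF True] z(2) by auto
    ultimately show ?thesis using q by blast
  next
    case False
    then have zp: "\<not> z < 0" and q: "q = node s' (z \<noteq> 0)" using z(3) p by auto
    obtain \<rho> where r: "is_run A \<rho>" "last \<rho> = (s, \<alpha>, 0)" "w = 0" using b0[OF False] by blast
    have e: "\<exists>\<rho>'. is_run A \<rho>' \<and> last \<rho>' = (s', \<beta>, of_int z)"
      using extend[OF r(1,2), of "of_int z" 1] zp by simp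
    have "\<forall>x<of_int (w + k). \<exists>\<rho> c. is_run A \<rho> \<and> last \<rho> = (s', \<beta>, c) \<and> 0 < c \<and> x < c" if "z \<noteq> 0"
    proof (intro allI impI)
      fix x :: real assume "x < of_int (w + k)"
      then have "x < of_int z" using r(3) z(2) zp by simp
      moreover have "(0::real) < of_int z" using that zp by simp
      ultimately show "\<exists>\<rho> c. is_run A \<rho> \<and> last \<rho> = (s', \<beta>, c) \<and> 0 < c \<and> x < c" using e by blast
    qed
    then show ?thesis using q e r(3) z(2) zp
      by (intro exI[of _ s'] exI[of _ "z \<noteq> 0"]) auto
  qed
  then show ?case by simp
qed
  from this[OF path] show ?thesis by simp
qed

section \<open>The tight bound as the maximal goal weight\<close>

definition goal_weights :: "(nat, nat) pvass \<Rightarrow> int set" where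
  "goal_weights A = {w. \<exists>\<alpha>. edge_path (edges A) (start_node A, [bottom A]) w (goal_node A, \<alpha>)}"

text \<open>The gap between \<open>\<le>\<close> and \<open><\<close> reflects that a path weight
  need not be attained by a run. A positive threshold forces phase 1 at the end, because phase 0
  means counter 0.\<close>

lemma covering_run_iff:
  assumes A: "is_pvass A" and k: "0 < k"
  shows "(\<exists>\<rho>. covering_run A k \<rho>) \<Longrightarrow> \<exists>w \<in> goal_weights A. k \<le> of_int w"
    and "\<exists>w \<in> goal_weights A. k < of_int w \<Longrightarrow> \<exists>\<rho>. covering_run A k \<rho>"
proof -
  assume "\<exists>\<rho>. covering_run A k \<rho>"
  then obtain \<rho> \<alpha> c where "is_run A \<rho>" "last \<rho> = (acc_state A, \<alpha>, c)" "k \<le> c"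
    by (auto simp: covering_run_def)
  with edge_path_of_run[OF A this(1,2)] k
  show "\<exists>w \<in> goal_weights A. k \<le> of_int w"
    unfolding goal_weights_def by (smt (verit) mem_Collect_eq)
next
  assume "\<exists>w \<in> goal_weights A. k < of_int w"
  then obtain w \<alpha> where w: "edge_path (edges A) (start_node A, [bottom A]) w (goal_node A, \<alpha>)"
    "k < of_int w" by (auto simp: goal_weights_def)
  from run_of_edge_path[OF A w(1)] w(2)
  obtain \<rho> c where "is_run A \<rho>" "last \<rho> = (acc_state A, \<alpha>, c)" "k < c"
    by (metis (full_types) node_inj)
  then show "\<exists>\<rho>. covering_run A k \<rho>" by (auto simp: covering_run_def intro: less_imp_le)
qed

lemma goal_weights_pos: "is_pvass A \<Longrightarrow> w \<in> goal_weights A \<Longrightarrow> 0 < w"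
  unfolding goal_weights_def by (auto dest: run_of_edge_path)

lemma tight_bound_eq:
  assumes A: "is_pvass A" and bdd: "bounded_pvass A"
  shows "finite (goal_weights A)"
    and "tight_bound A = of_int (if goal_weights A = {} then 0 else Max (goal_weights A))"
proof -
  obtain k where k: "0 \<le> k" "\<not> (\<exists>\<rho>. covering_run A k \<rho>)" using bdd by (auto simp: bounded_pvass_def)
  \<comment> \<open>\<open>k\<close> may be 0, whereas paths translate into covering runs for
    positive thresholds; hence the detour through \<open>k + 1\<close>.\<close>
  have "w \<le> \<lfloor>k + 1\<rfloor>" if w: "w \<in> goal_weights A" for w
  proof (rule ccontr)
    assume "\<not> w \<le> \<lfloor>k + 1\<rfloor>"
    then have "k + 1 < of_int w" by linarith
    then obtain \<rho> where "covering_run A (k + 1) \<rho>"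
      using covering_run_iff(2)[OF A, of "k + 1"] k(1) w by force
    then have "covering_run A k \<rho>" by (auto simp: covering_run_def)
    then show False using k by blast
  qed
  then have "goal_weights A \<subseteq> {0..\<lfloor>k + 1\<rfloor>}" using goal_weights_pos[OF A] by force
  then show fin: "finite (goal_weights A)" by (rule finite_subset) simp
  \<comment> \<open>If no path ends at the goal in phase 1, the accepting state is reached with
    counter 0 or not at all. Every positive threshold is then uncovered and the infimum is
    0.\<close>
  define m where "m = (if goal_weights A = {} then 0 else Max (goal_weights A))"
  have m: "w \<le> m" if "w \<in> goal_weights A" for w using that fin by (auto simp: m_def)
  have m0: "0 \<le> m" using goal_weights_pos[OF A] fin Max_in
    by (auto simp: m_def intro: less_imp_le)
  let ?K = "{k. 0 \<le> k \<and> \<not> (\<exists>\<rho>. covering_run A k \<rho>)}"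
  have lower: "of_int m \<le> x" if x: "x \<in> ?K" for x
  proof (rule ccontr)
    assume c: "\<not> of_int m \<le> x"
    then have "0 < m" using x by (smt (verit) mem_Collect_eq of_int_0_less_iff)
    then have mw: "m \<in> goal_weights A" using fin Max_in by (auto simp: m_def split: if_splits)
    \<comment> \<open>\<open>x\<close> may be 0, so the midpoint serves as a positive threshold
      below \<open>m\<close>; a run covering it also covers \<open>x\<close>.\<close>
    define y where "y = (x + of_int m) / 2"
    have y: "0 < y" "x < y" "y < of_int m" using c x by (auto simp: y_def)
    then obtain \<rho> where "covering_run A y \<rho>" using covering_run_iff(2)[OF A] mw by blast
    then have "covering_run A x \<rho>" using y by (auto simp: covering_run_def)
    then show False using x by blast
  qed
  have upper: "x \<in> ?K" if "of_int m < x" for x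
    using covering_run_iff(1)[OF A, of x] that m0 m
    by (smt (verit) mem_Collect_eq of_int_0_le_iff of_int_le_iff)
  have "Inf ?K = of_int m"
  proof (rule cInf_eq_non_empty)
    show "?K \<noteq> {}" using k by blast
    show "of_int m \<le> x" if "x \<in> ?K" for x by (rule lower[OF that])
    show "y \<le> of_int m" if "\<And>x. x \<in> ?K \<Longrightarrow> y \<le> x" for y :: real
      by (rule dense_ge) (use upper that in blast)
  qed
  then show "tight_bound A = of_int (if goal_weights A = {} then 0 else Max (goal_weights A))"
    unfolding tight_bound_def m_def .
qed

lemma tight_bound_Nats:
  fixes A :: "(nat, nat) pvass"
  assumes A: "is_pvass A" and bdd: "bounded_pvass A"
  shows "tight_bound A \<in> \<nat>"
proof -
  have "0 \<le> (if goal_weights A = {} then 0 else Max (goal_weights A))"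
    using tight_bound_eq(1)[OF A bdd] goal_weights_pos[OF A] Max_in by (auto intro: less_imp_le)
  then show ?thesis unfolding tight_bound_eq(2)[OF A bdd]
    by (metis of_nat_in_Nats of_int_of_nat_eq zero_le_imp_eq_int)
qed

section \<open>Paths as derivations\<close>

text \<open>The first half is an edge that pushes \<open>sym1\<close>, the second an edge that pops
  \<open>sym2\<close>. The eight integer fields correspond to eight consecutive memory
  cells.\<close>

datatype rule_pair = RulePair
  (src1: int) (dst1: int) (wt1: int) (sym1: int) (src2: int) (dst2: int) (wt2: int) (sym2: int)

text \<open>
  An edge is replaced by an edge with a push and one with a pop. Transitions without stack
  operation push and pop a symbol \<open>u\<close> of their own; a pushed symbol may also be dropped
  in the sink \<open>0\<close>, so that only paths with an unchanged stack have to be considered.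
\<close>
fun rule_pair_of :: "int \<Rightarrow> edge \<Rightarrow> rule_pair" where
  "rule_pair_of u (p, q, w, NoOp) = RulePair p p w u p q 0 u"
| "rule_pair_of u (p, q, w, Push a) = RulePair p q w (int a) 0 0 0 (int a)"
| "rule_pair_of u (p, q, w, Pop a) = RulePair p p 0 u p q w (int a)"

text \<open>The symbol \<open>u\<close> is the negated memory address of the pair in the program below.\<close>
definition rule_pairs :: "edge list \<Rightarrow> rule_pair list" where
  "rule_pairs es = map (\<lambda>i. rule_pair_of (- (32 + 8 * int i)) (es ! i)) [0..<length es]"

lemma rule_pairs_snoc:
  "rule_pairs (es @ [e]) = rule_pairs es @ [rule_pair_of (- (32 + 8 * int (length es))) e]"
  unfolding rule_pairs_def by (auto simp: nth_append intro!: nth_equalityI)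

lemma length_rule_pairs [simp]: "length (rule_pairs es) = length es"
  by (simp add: rule_pairs_def)

definition axioms_of :: "rule_pair set \<Rightarrow> (int \<times> int) set" where
  "axioms_of U = (\<lambda>r. (src1 r, src1 r)) ` U"

text \<open>A pair (p, q) stands for the paths from p to q with unchanged stack. A nonempty one ends
  with a pop; it splits into a path up to the matching push, the push, an inner path and the pop.
  This one shape covers concatenation and nesting, with (p, p) as base. \<open>r0\<close> supplies
  the start node, so an instance is determined by three table entries and can be enumerated by three
  nested loops.\<close>

definition rules_of :: "rule_pair set \<Rightarrow> ((int \<times> int) \<times> (int \<times> int) \<times> (int \<times> int) \<times> int) set" where
  "rules_of U = {((src1 r0, dst2 r2), (src1 r0, src1 r1), (dst1 r1, src2 r2), wt1 r1 + wt2 r2) | r0 r1 r2.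
     r0 \<in> U \<and> r1 \<in> U \<and> r2 \<in> U \<and> sym1 r1 = sym2 r2}"

definition all_edges :: "(nat, nat) pvass \<Rightarrow> edge list" where
  "all_edges A = (goal_node A, 0, 0, NoOp) # concat (map edges_of (transition_list A))"

lemma set_all_edges: "set (all_edges A) = insert (goal_node A, 0, 0, NoOp) (edges A)"
  by (auto simp: all_edges_def edges_def)

lemma mem_rule_pairs:
  "r \<in> set (rule_pairs es) \<longleftrightarrow> (\<exists>i<length es. r = rule_pair_of (- (32 + 8 * int i)) (es ! i))"
  by (auto simp: rule_pairs_def)

lemma wt_rule_pairs_nonneg:
  assumes "\<And>p q w opr. (p, q, w, opr) \<in> set es \<Longrightarrow> 0 \<le> w" "r \<in> set (rule_pairs es)"
  shows "0 \<le> wt1 r" "0 \<le> wt2 r"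
proof -
  obtain i where i: "i < length es" "r = rule_pair_of (- (32 + 8 * int i)) (es ! i)"
    using assms(2) mem_rule_pairs by blast
  obtain p q w opr where e: "es ! i = (p, q, w, opr)" by (metis prod_cases4)
  then have "0 \<le> w" using assms(1) i(1) nth_mem by metis
  then show "0 \<le> wt1 r" "0 \<le> wt2 r" using i(2) e by (cases opr; simp)+
qed

text \<open>Private symbols are negative and determine the index of their entry, whereas stack
  symbols are nonnegative. So a \<open>NoOp\<close> entry matches itself alone, and the dummy push
  of a \<open>Pop\<close> entry, which makes the source of the edge appear as \<open>src1\<close>,
  matches nothing.\<close>

lemma matching_rule_pairs_cases:
  assumes r: "r1 \<in> set (rule_pairs es)" "r2 \<in> set (rule_pairs es)" "sym1 r1 = sym2 r2"
  obtains (NoOp) p q w where "(p, q, w, NoOp) \<in> set es" "src1 r1 = p" "dst1 r1 = p" "src2 r2 = p"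
      "dst2 r2 = q" "wt1 r1 + wt2 r2 = w"
  | (Match) a p q w p' q' w' where "(p, q, w, Push a) \<in> set es" "(p', q', w', Pop a) \<in> set es"
      "src1 r1 = p" "dst1 r1 = q" "src2 r2 = p'" "dst2 r2 = q'" "wt1 r1 = w" "wt2 r2 = w'"
  | (Drop) a p q w where "(p, q, w, Push a) \<in> set es" "src1 r1 = p" "dst1 r1 = q" "src2 r2 = 0"
      "dst2 r2 = 0" "wt1 r1 = w" "wt2 r2 = 0"
proof -
  obtain i where i: "i < length es" "r1 = rule_pair_of (- (32 + 8 * int i)) (es ! i)"
    using r(1) mem_rule_pairs by blast
  obtain j where j: "j < length es" "r2 = rule_pair_of (- (32 + 8 * int j)) (es ! j)"
    using r(2) mem_rule_pairs by blast
  obtain p q w opr where e: "es ! i = (p, q, w, opr)" by (metis prod_cases4)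
  obtain p' q' w' opr' where e': "es ! j = (p', q', w', opr')" by (metis prod_cases4)
  have mem: "(p, q, w, opr) \<in> set es" "(p', q', w', opr') \<in> set es"
    using e e' i(1) j(1) nth_mem by metis+
  show ?thesis
  proof (cases opr)
    case o1: (Push a)
    show ?thesis
    proof (cases opr')
      case (Push b)
      then show ?thesis using Drop[of p q w a] mem e e' i(2) j(2) r(3) o1 by simp
    next
      case (Pop b)
      then show ?thesis using Match[of p q w a p' q' w'] mem e e' i(2) j(2) r(3) o1 by simp
    next
      case NoOp
      then show ?thesis using e e' i(2) j(2) r(3) o1 by simp
    qed
  next
    case o1: (Pop a)
    then show ?thesis using e e' i(2) j(2) r(3) NoOp mem by (cases opr') auto
  next
    case o1: NoOp
    then show ?thesis using e e' i(2) j(2) r(3) NoOp mem by (cases opr') auto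
  qed
qed

lemma rule_pair_of_in:
  assumes "e \<in> set es"
  obtains u where "rule_pair_of u e \<in> set (rule_pairs es)"
proof -
  obtain i where "i < length es" "es ! i = e" using assms by (auto simp: in_set_conv_nth)
  then have "rule_pair_of (- (32 + 8 * int i)) e \<in> set (rule_pairs es)" by (auto simp: mem_rule_pairs)
  then show ?thesis by (rule that)
qed

section \<open>Soundness and completeness of the grammar for paths\<close>

context
  fixes A :: "(nat, nat) pvass"
begin

private abbreviation "U \<equiv> set (rule_pairs (all_edges A))"
private abbreviation "path \<equiv> edge_path (edges A)"

text \<open>A second component 0 means that the goal is reached with further symbols
  \<open>\<beta>\<close> above the starting stack, which the sink then drops. The quantification
  over \<open>\<alpha>\<close> allows a subderivation to be used on top of a pushed symbol.\<close>

lemma tree_sound: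
  "tree (axioms_of U) (rules_of U) x w n \<Longrightarrow> fst x \<noteq> 0 \<and>
    (snd x \<noteq> 0 \<longrightarrow> (\<forall>\<alpha>. path (fst x, \<alpha>) w (snd x, \<alpha>))) \<and>
    (snd x = 0 \<longrightarrow> (\<forall>\<alpha>. \<exists>\<beta>. path (fst x, \<alpha>) w (goal_node A, \<beta> @ \<alpha>)))"
proof (induction rule: tree.induct)
  case (ax x)
  then obtain r where r: "r \<in> U" "x = (src1 r, src1 r)" by (auto simp: axioms_of_def)
  then obtain i where i: "i < length (all_edges A)" "r = rule_pair_of (- (32 + 8 * int i)) (all_edges A ! i)"
    using mem_rule_pairs by blast
  obtain p q w opr where e: "all_edges A ! i = (p, q, w, opr)" by (metis prod_cases4)
  then have "(p, q, w, opr) \<in> set (all_edges A)" using i nth_mem by metis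
  then have "p \<noteq> 0" by (auto simp: set_all_edges edges_def)
  then show ?case using r i e by (cases opr) (auto intro: edge_path.nil)
next
  case (rl x y z k w1 n1 w2 n2)
  then obtain r0 r1 r2 where r: "r0 \<in> U" "r1 \<in> U" "r2 \<in> U" "sym1 r1 = sym2 r2"
    "x = (src1 r0, dst2 r2)" "y = (src1 r0, src1 r1)" "z = (dst1 r1, src2 r2)" "k = wt1 r1 + wt2 r2"
    by (auto simp: rules_of_def)
  have s0: "src1 r0 \<noteq> 0" using rl.IH(1) r by simp
  from r(2-4) show ?case
  proof (cases rule: matching_rule_pairs_cases)
    case (NoOp p q w)
    have p: "p \<noteq> 0" using NoOp(1) by (auto simp: set_all_edges edges_def)
    have yz: "path (src1 r0, \<alpha>) (w1 + w2) (p, \<alpha>)" for \<alpha>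
      using edge_path_trans[of "edges A" "(src1 r0, \<alpha>)" w1 "(p, \<alpha>)" w2 "(p, \<alpha>)"] rl.IH r NoOp p by auto
    show ?thesis
    proof (cases "q = 0")
      case True
      then have "p = goal_node A" "w = 0" using NoOp(1) by (auto simp: set_all_edges edges_def)
      then have "path (src1 r0, \<alpha>) (w1 + w2 + k) (goal_node A, [] @ \<alpha>)" for \<alpha>
        using yz[of \<alpha>] NoOp r(8) by simp
      then show ?thesis using s0 r True NoOp by (metis fst_conv snd_conv)
    next
      case False
      then have "(p, q, w, NoOp) \<in> edges A" using NoOp(1) by (auto simp: set_all_edges)
      then have "path (src1 r0, \<alpha>) (w1 + w2 + w) (q, \<alpha>)" for \<alpha>
        using edge_path.snoc[OF yz] by fastforce
      then show ?thesis using s0 r False NoOp by simp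
    qed
  next
    case (Match a p q w p' q' w')
    have E: "(p, q, w, Push a) \<in> edges A" "(p', q', w', Pop a) \<in> edges A"
      using Match(1,2) by (auto simp: set_all_edges)
    then have nz: "p \<noteq> 0" "p' \<noteq> 0" "q' \<noteq> 0" by (auto simp: edges_def)
    have "path (src1 r0, \<alpha>) (w1 + w + w2 + w') (q', \<alpha>)" for \<alpha>
    proof (rule edge_path.snoc[OF _ E(2)])
      have "path (src1 r0, \<alpha>) w1 (p, \<alpha>)" using rl.IH(1) r Match nz by simp
      from edge_path.snoc[OF this E(1), of "a # \<alpha>"]
      have "path (src1 r0, \<alpha>) (w1 + w) (q, a # \<alpha>)" by simp
      moreover have "path (q, a # \<alpha>) w2 (p', a # \<alpha>)" using rl.IH(2) r Match nz by simp
      ultimately show "path (src1 r0, \<alpha>) (w1 + w + w2) (p', a # \<alpha>)" by (rule edge_path_trans)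
    qed simp
    then have "path (src1 r0, \<alpha>) (w1 + w2 + k) (q', \<alpha>)" for \<alpha>
      using r(8) Match by (simp add: algebra_simps)
    then show ?thesis using s0 nz r Match by simp
  next
    case (Drop a p q w)
    have E: "(p, q, w, Push a) \<in> edges A" using Drop(1) by (auto simp: set_all_edges)
    then have nz: "p \<noteq> 0" by (auto simp: edges_def)
    have "\<exists>\<beta>. path (src1 r0, \<alpha>) (w1 + w + w2) (goal_node A, \<beta> @ \<alpha>)" for \<alpha>
    proof -
      have "path (src1 r0, \<alpha>) w1 (p, \<alpha>)" using rl.IH(1) r Drop nz by simp
      from edge_path.snoc[OF this E, of "a # \<alpha>"]
      have 1: "path (src1 r0, \<alpha>) (w1 + w) (q, a # \<alpha>)" by simp
      obtain \<beta> where "path (q, a # \<alpha>) w2 (goal_node A, \<beta> @ a # \<alpha>)" using rl.IH(2) r Drop by auto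
      then have "path (src1 r0, \<alpha>) (w1 + w + w2) (goal_node A, (\<beta> @ [a]) @ \<alpha>)"
        using edge_path_trans[OF 1] by simp
      then show ?thesis by blast
    qed
    then have "\<exists>\<beta>. path (src1 r0, \<alpha>) (w1 + w2 + k) (goal_node A, \<beta> @ \<alpha>)" for \<alpha>
      using r(8) Drop by (simp add: algebra_simps)
    then show ?thesis using s0 r Drop by simp
  qed
qed

private definition derivable :: "int \<times> int \<Rightarrow> int \<Rightarrow> bool" where
  "derivable x w \<longleftrightarrow> (\<exists>n. tree (axioms_of U) (rules_of U) x w n)"

text \<open>Axioms exist only for sources; an underivable reflexive pair stands for a node without successors.\<close>
private definition derivable' :: "int \<Rightarrow> int \<Rightarrow> int \<Rightarrow> bool" where
  "derivable' p q w \<longleftrightarrow> derivable (p, q) w \<or> p = q \<and> w = 0"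

private lemma derivable_rule:
  assumes "derivable (p, src1 r1) w1" "derivable (dst1 r1, src2 r2) w2"
    "r1 \<in> U" "r2 \<in> U" "sym1 r1 = sym2 r2"
  shows "derivable (p, dst2 r2) (w1 + w2 + (wt1 r1 + wt2 r2))"
proof -
  obtain n1 n2 where t: "tree (axioms_of U) (rules_of U) (p, src1 r1) w1 n1"
    "tree (axioms_of U) (rules_of U) (dst1 r1, src2 r2) w2 n2" using assms by (auto simp: derivable_def)
  \<comment> \<open>Axioms and rules alike have some \<open>src1\<close> as their first component;
    this provides the \<open>r0\<close> of the new rule instance.\<close>
  from t(1) obtain r0 where "r0 \<in> U" "p = src1 r0"
    by cases (auto simp: axioms_of_def rules_of_def)
  then have "((p, dst2 r2), (p, src1 r1), (dst1 r1, src2 r2), wt1 r1 + wt2 r2) \<in> rules_of U"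
    using assms(3-5) unfolding rules_of_def by blast
  from tree.rl[OF this t] show ?thesis by (auto simp: derivable_def)
qed

private lemma derivable_ax:
  assumes "(p, q, w, opr) \<in> set (all_edges A)"
  shows "derivable (p, p) 0"
proof -
  obtain u where u: "rule_pair_of u (p, q, w, opr) \<in> U" using rule_pair_of_in assms by blast
  have "src1 (rule_pair_of u (p, q, w, opr)) = p" by (cases opr) simp_all
  then have "(p, p) \<in> axioms_of U" using u unfolding axioms_of_def by force
  then show ?thesis unfolding derivable_def by (blast intro: tree.ax)
qed

private lemma derivable_of_derivable':
  "derivable' p q w \<Longrightarrow> (q, q', w', opr) \<in> set (all_edges A) \<Longrightarrow> derivable (p, q) w"
  using derivable_ax by (auto simp: derivable'_def)

private lemma derivable_NoOp:
  assumes "derivable' p q w" "(q, q', w', NoOp) \<in> set (all_edges A)"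
  shows "derivable (p, q') (w + w')"
proof -
  obtain u where "rule_pair_of u (q, q', w', NoOp) \<in> U" using rule_pair_of_in assms(2) by blast
  \<comment> \<open>The entry serves as push and as pop; between its two halves lies the axiom at
    \<open>q\<close>, of weight 0.\<close>
  from derivable_rule[of p "rule_pair_of u (q, q', w', NoOp)" w "rule_pair_of u (q, q', w', NoOp)" 0, OF _ _ this this]
  show ?thesis using derivable_of_derivable'[OF assms] derivable_ax[OF assms(2)] by simp
qed

private lemma derivable_Push_Pop:
  assumes "derivable' p q1 w1" "(q1, p', k1, Push a) \<in> set (all_edges A)"
    "derivable' p' q2 w2" "(q2, q, k2, Pop a) \<in> set (all_edges A)"
  shows "derivable (p, q) (w1 + k1 + w2 + k2)"
proof -
  obtain u where u: "rule_pair_of u (q1, p', k1, Push a) \<in> U" using rule_pair_of_in assms(2) by blast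
  obtain v where v: "rule_pair_of v (q2, q, k2, Pop a) \<in> U" using rule_pair_of_in assms(4) by blast
  from derivable_rule[of p "rule_pair_of u (q1, p', k1, Push a)" w1 "rule_pair_of v (q2, q, k2, Pop a)" w2, OF _ _ u v]
  show ?thesis
    using derivable_of_derivable'[OF assms(1,2)] derivable_of_derivable'[OF assms(3,4)]
    by (simp add: algebra_simps)
qed

text \<open>The push entry is matched with its own second half, which pops the symbol in the sink;
  \<open>w2\<close> is the weight of the way into the sink after the push.\<close>

private lemma derivable_Push_Drop:
  assumes "derivable' p q1 w1" "(q1, p', k1, Push a) \<in> set (all_edges A)" "derivable (p', 0) w2"
  shows "derivable (p, 0) (w1 + k1 + w2)"
proof -
  obtain u where u: "rule_pair_of u (q1, p', k1, Push a) \<in> U" using rule_pair_of_in assms(2) by blast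
  from derivable_rule[of p "rule_pair_of u (q1, p', k1, Push a)" w1 "rule_pair_of u (q1, p', k1, Push a)" w2, OF _ _ u u]
  show ?thesis
    using derivable_of_derivable'[OF assms(1,2)] assms(3)
    by (simp add: algebra_simps)
qed

text \<open>A path decomposes at the last pushes of the symbols that are still on the stack.\<close>
private inductive levels :: "int \<Rightarrow> nat list \<Rightarrow> int \<Rightarrow> int \<Rightarrow> bool" for p0 where
  base: "derivable' p0 q w \<Longrightarrow> levels p0 [b] q w"
| push: "\<lbrakk>levels p0 \<alpha> q1 w1; (q1, p, k, Push a) \<in> edges A; derivable' p q w2\<rbrakk>
         \<Longrightarrow> levels p0 (a # \<alpha>) q (w1 + k + w2)"

private lemma levels_top:
  assumes "levels p0 \<alpha> q w" "\<And>p v. derivable' p q v \<Longrightarrow> derivable' p q' (v + k)"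
  shows "levels p0 \<alpha> q' (w + k)"
  using assms(1)
proof cases
  case (base b)
  then show ?thesis using assms(2) levels.base by blast
next
  case (push \<alpha>' q1 w1 p k' a w2)
  have "levels p0 (a # \<alpha>') q' (w1 + k' + (w2 + k))"
    using push assms(2) by (intro levels.push) auto
  then show ?thesis using push by (simp add: algebra_simps)
qed

private lemma levels_NoOp:
  assumes "levels p0 \<alpha> q w" "(q, q', k, NoOp) \<in> set (all_edges A)"
  shows "levels p0 \<alpha> q' (w + k)"
  using assms(1)
  by (rule levels_top) (auto simp: derivable'_def[of _ q'] intro: derivable_NoOp assms)

text \<open>A push opens a new segment, a pop merges the topmost segment into the one below, and any
  other edge prolongs the topmost one. The bottom symbol is never popped, so a pop always finds a
  segment below.\<close>

private lemma levels_step: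
  assumes "levels p0 \<alpha> q w" "(q, q', k, opr) \<in> edges A" "stack_step opr \<alpha> \<beta>" "last \<alpha> = bottom A"
    and A: "is_pvass A"
  shows "levels p0 \<beta> q' (w + k)"
proof (cases opr)
  case (Push a)
  then have "levels p0 (a # \<alpha>) q' (w + k + 0)"
    using assms by (intro levels.push) (auto simp: derivable'_def)
  then show ?thesis using Push assms(3) by simp
next
  case (Pop a)
  have "a \<noteq> bottom A"
    using assms(2) A Pop edges_iff[OF A] unfolding is_pvass_def by (fastforce intro: ranI)
  then have ne: "\<beta> \<noteq> []" using assms(3,4) Pop by auto
  have e: "(q, q', k, Pop a) \<in> set (all_edges A)" using assms(2) Pop by (simp add: set_all_edges)
  from assms(1) show ?thesis
  proof cases
    case (base b)
    then show ?thesis using ne assms(3) Pop by simp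
  next
    case (push \<alpha>' q1 w1 p k' a' w2)
    then have [simp]: "a' = a" "\<alpha>' = \<beta>" using assms(3) Pop by auto
    have e1: "(q1, p, k', Push a) \<in> set (all_edges A)" using push by (simp add: set_all_edges)
    have "levels p0 \<beta> q' (w1 + (k' + w2 + k))"
      using push(3)[simplified]
      by (rule levels_top)
        (use derivable_Push_Pop[OF _ e1 push(5) e] in \<open>auto simp: derivable'_def[of _ q'] algebra_simps\<close>)
    then show ?thesis using push by (simp add: algebra_simps)
  qed
next
  case NoOp
  then show ?thesis using levels_NoOp assms by (simp add: set_all_edges)
qed

private lemma levels_path:
  assumes A: "is_pvass A" and "path (p0, [bottom A]) w c"
  shows "levels p0 (snd c) (fst c) w \<and> last (snd c) = bottom A"
  using assms(2)
proof (induction rule: edge_path.induct)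
  case nil
  then show ?case by (auto simp: derivable'_def intro: levels.base)
next
  case (snoc w p \<alpha> q z opr \<beta>)
  have "levels p0 \<beta> q (w + z)" using levels_step[OF _ snoc.hyps(2,3) _ A] snoc.IH by simp
  moreover have "\<alpha> \<noteq> []" using snoc.IH by (auto elim: levels.cases)
  moreover have "\<beta> \<noteq> []" using \<open>levels p0 \<beta> q (w + z)\<close> by (auto elim: levels.cases)
  ultimately show ?case using snoc.IH snoc.hyps(3) by (cases opr) auto
qed

text \<open>In the sink the open levels are discharged from the top: dropping the most recent push
  turns it and the segment above it into a prolongation of the segment below.\<close>

private lemma levels_sink:
  "levels p0 \<alpha> 0 w \<Longrightarrow> p0 \<noteq> 0 \<Longrightarrow> derivable (p0, 0) w"
proof (induction \<alpha> arbitrary: w)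
  case Nil
  then show ?case by (auto elim: levels.cases)
next
  case (Cons a \<alpha>)
  from Cons.prems(1) show ?case
  proof cases
    case base
    then show ?thesis using Cons.prems by (simp add: derivable'_def)
  next
    case (push q1 w1 p k w2)
    have e: "(q1, p, k, Push a) \<in> set (all_edges A)" using push by (simp add: set_all_edges)
    \<comment> \<open>This excludes the reflexive alternative of \<open>derivable'\<close> at the
      sink, for which no axiom exists.\<close>
    have "p \<noteq> 0" using push by (auto simp: edges_def)
    then have "derivable (p, 0) w2" using push by (simp add: derivable'_def)
    then have "derivable' p' 0 (v + (k + w2))" if "derivable' p' q1 v" for p' v
      using derivable_Push_Drop[OF that e] by (simp add: derivable'_def add.assoc)
    then have "levels p0 \<alpha> 0 (w1 + (k + w2))" using push(2) by (intro levels_top)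
    then show ?thesis using Cons.IH[of w] Cons.prems(2) push(1) by (simp add: add.assoc)
  qed
qed

lemma goal_weights_eq:
  assumes A: "is_pvass A"
  shows "goal_weights A = {w. \<exists>n. tree (axioms_of U) (rules_of U) (start_node A, 0) w n}"
proof (intro equalityI subsetI CollectI)
  fix w assume "w \<in> goal_weights A"
  then obtain \<alpha> where "path (start_node A, [bottom A]) w (goal_node A, \<alpha>)"
    by (auto simp: goal_weights_def)
  from levels_path[OF A this] have "levels (start_node A) \<alpha> (goal_node A) w" by simp
  then have "levels (start_node A) \<alpha> 0 (w + 0)"
    by (rule levels_NoOp) (simp add: set_all_edges)
  from levels_sink[OF this] show "\<exists>n. tree (axioms_of U) (rules_of U) (start_node A, 0) w n"
    by (simp add: derivable_def)
next
  fix w assume "w \<in> {w. \<exists>n. tree (axioms_of U) (rules_of U) (start_node A, 0) w n}"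
  then show "w \<in> goal_weights A"
    using tree_sound by (fastforce simp: goal_weights_def)
qed

end

section \<open>Rounds of relaxation\<close>

text \<open>The axiom cell is set in the innermost step, where the row of \<open>r0\<close> is at
  hand, so the rounds can start from cells that are all 0.\<close>

definition step_cells :: "rule_pair \<Rightarrow> rule_pair \<Rightarrow> rule_pair \<Rightarrow> (int \<times> int \<Rightarrow> int) \<Rightarrow> int \<times> int \<Rightarrow> int" where
  "step_cells r0 r1 r2 V = (let V' = init_cell (src1 r0, src1 r0) V in
     if sym1 r1 = sym2 r2
     then relax (src1 r0, dst2 r2) (src1 r0, src1 r1) (dst1 r1, src2 r2) (wt1 r1 + wt2 r2) V' else V')"

definition round_cells :: "rule_pair list \<Rightarrow> (int \<times> int \<Rightarrow> int) \<Rightarrow> int \<times> int \<Rightarrow> int" where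
  "round_cells us = fold (\<lambda>r0. fold (\<lambda>r1. fold (\<lambda>r2. step_cells r0 r1 r2) us) us) us"

lemma le_step_cells: "V \<le> step_cells r0 r1 r2 V"
  unfolding step_cells_def Let_def using le_init_cell le_relax order_trans by fastforce

lemma sound_step_cells:
  assumes "r0 \<in> U" "r1 \<in> U" "r2 \<in> U" "sound_cells (axioms_of U) (rules_of U) V"
  shows "sound_cells (axioms_of U) (rules_of U) (step_cells r0 r1 r2 V)"
proof -
  have "sound_cells (axioms_of U) (rules_of U) (init_cell (src1 r0, src1 r0) V)"
    using assms by (intro sound_init_cell) (auto simp: axioms_of_def)
  moreover have "sym1 r1 = sym2 r2 \<Longrightarrow>
    ((src1 r0, dst2 r2), (src1 r0, src1 r1), (dst1 r1, src2 r2), wt1 r1 + wt2 r2) \<in> rules_of U"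
    using assms unfolding rules_of_def by blast
  ultimately show ?thesis unfolding step_cells_def Let_def by (auto intro: sound_relax)
qed

lemma sound_round_cells:
  assumes "sound_cells (axioms_of (set us)) (rules_of (set us)) V"
  shows "sound_cells (axioms_of (set us)) (rules_of (set us)) (round_cells us V)"
  unfolding round_cells_def
  by (intro fold_preserves[where P = "sound_cells (axioms_of (set us)) (rules_of (set us))"]
      sound_step_cells assms)

lemma round_cells_reaches:
  assumes r: "r0 \<in> set us" "r1 \<in> set us" "r2 \<in> set us" and "V0 \<le> V"
    and Q: "\<And>V. V0 \<le> V \<Longrightarrow> Q (step_cells r0 r1 r2 V)" "\<And>V V'. Q V \<Longrightarrow> V \<le> V' \<Longrightarrow> Q V'"
  shows "Q (round_cells us V)"
  unfolding round_cells_def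
proof (rule fold_reaches[OF _ r(1) \<open>V0 \<le> V\<close> _ Q(2)])
  fix V assume "V0 \<le> V"
  show "Q (fold (\<lambda>r1. fold (step_cells r0 r1) us) us V)"
  proof (rule fold_reaches[OF _ r(2) \<open>V0 \<le> V\<close> _ Q(2)])
    fix V assume "V0 \<le> V"
    show "Q (fold (step_cells r0 r1) us V)"
    proof (rule fold_reaches[OF _ r(3) \<open>V0 \<le> V\<close>])
      show "V \<le> step_cells r0 r1 r2 V" for r2 V by (rule le_step_cells)
    qed (fact Q)+
  qed (intro le_fold le_step_cells)
qed (intro le_fold le_step_cells)

text \<open>One round raises the guaranteed height by one: when the rule instance at the root is
  processed, the cells of both children still hold at least their values from the start of the
  round. \<open>0 \<le> w\<close> is carried along because \<open>relax\<close> acts on positive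
  cells only.\<close>

lemma rounds_complete:
  fixes us :: "rule_pair list"
  defines "U \<equiv> set us"
  assumes nonneg: "\<And>r. r \<in> U \<Longrightarrow> 0 \<le> wt1 r \<and> 0 \<le> wt2 r"
  shows "tree_height (axioms_of U) (rules_of U) h x w \<Longrightarrow> 0 \<le> w \<and> w + 1 \<le> (round_cells us ^^ h) (\<lambda>_. 0) x"
proof (induction rule: tree_height.induct)
  case (ax x h)
  then obtain r where r: "r \<in> set us" "x = (src1 r, src1 r)" by (auto simp: axioms_of_def U_def)
  let ?V = "(round_cells us ^^ h) (\<lambda>_. 0)"
  have "0 + 1 \<le> round_cells us ?V x"
  proof (rule round_cells_reaches[OF r(1) r(1) r(1) order_refl])
    fix V
    have "1 \<le> init_cell x V x" by (auto simp: init_cell_def)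
    then have "1 \<le> relax a b c k (init_cell x V) x" for a b c k
      using le_funD[OF le_relax] by (rule order_trans)
    with \<open>1 \<le> init_cell x V x\<close> show "0 + 1 \<le> step_cells r r r V x"
      using r(2) by (simp add: step_cells_def Let_def)
  qed (erule order_trans, erule le_funD)
  then show ?case by simp
next
  case (rl x y z k h w1 w2)
  then obtain r0 r1 r2 where r: "r0 \<in> set us" "r1 \<in> set us" "r2 \<in> set us" "sym1 r1 = sym2 r2"
    "x = (src1 r0, dst2 r2)" "y = (src1 r0, src1 r1)" "z = (dst1 r1, src2 r2)" "k = wt1 r1 + wt2 r2"
    by (auto simp: rules_of_def U_def)
  let ?V = "(round_cells us ^^ h) (\<lambda>_. 0)"
  have w: "0 \<le> w1" "0 \<le> w2" using rl.IH by simp_all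
  have "w1 + w2 + k + 1 \<le> round_cells us ?V x"
  proof (rule round_cells_reaches[OF r(1-3) order_refl])
    fix V assume V: "?V \<le> V"
    define V' where "V' = init_cell (src1 r0, src1 r0) V"
    have V': "?V \<le> V'" unfolding V'_def using V le_init_cell by (rule order_trans)
    have "w1 + 1 \<le> V' y" "w2 + 1 \<le> V' z"
      using rl.IH le_funD[OF V', of y] le_funD[OF V', of z] by linarith+
    then have "w1 + w2 + k + 1 \<le> relax x y z k V' x" using w by (auto simp: relax_def)
    then show "w1 + w2 + k + 1 \<le> step_cells r0 r1 r2 V x"
      using r unfolding step_cells_def V'_def by simp
  qed (erule order_trans, erule le_funD)
  moreover have "0 \<le> w1 + w2 + k" using w r nonneg by (simp add: U_def)
  ultimately show ?case by simp
qed

lemma sound_rounds: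
  "sound_cells (axioms_of (set us)) (rules_of (set us)) ((round_cells us ^^ h) (\<lambda>_. 0))"
  by (induction h) (auto intro: sound_round_cells simp: sound_cells_def[of _ _ "\<lambda>_. 0"])

text \<open>Completeness is applied to a tree of maximal weight, whose height is at most the number
  of cells. In the other direction, a positive entry is one more than the weight of an actual tree,
  hence at most one more than the maximum.\<close>

lemma rounds_goal:
  assumes A: "is_pvass A" and bdd: "bounded_pvass A" and h: "(length (all_edges A) + 1)\<^sup>2 \<le> h"
  shows "(round_cells (rule_pairs (all_edges A)) ^^ h) (\<lambda>_. 0) (start_node A, 0) =
    (if goal_weights A = {} then 0 else Max (goal_weights A) + 1)"
proof -
  define us where "us = rule_pairs (all_edges A)"
  define U where "U = set us"
  let ?x = "(start_node A, 0)" and ?V = "(round_cells us ^^ h) (\<lambda>_. 0)"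
  have G: "goal_weights A = {w. \<exists>n. tree (axioms_of U) (rules_of U) ?x w n}"
    unfolding U_def us_def by (rule goal_weights_eq[OF A])
  have sound: "sound_cells (axioms_of U) (rules_of U) ?V" unfolding U_def by (rule sound_rounds)
  have nonneg: "0 \<le> wt1 r \<and> 0 \<le> wt2 r" if "r \<in> U" for r
    using that wt_rule_pairs_nonneg[of "all_edges A" r]
    by (auto simp: U_def us_def set_all_edges dest: edges_weight_nonneg)
  show ?thesis
  proof (cases "goal_weights A = {}")
    case True
    then have "\<not> 0 < ?V ?x" "0 \<le> ?V ?x" using sound G unfolding sound_cells_def by blast+
    then show ?thesis using True unfolding us_def[symmetric] by simp
  next
    case False
    define m where "m = Max (goal_weights A)"
    have m: "m \<in> goal_weights A" "\<And>w. w \<in> goal_weights A \<Longrightarrow> w \<le> m"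
      unfolding m_def using tight_bound_eq(1)[OF A bdd] False by auto
    \<comment> \<open>These are all left-hand sides: a source paired with the target of a pop, or
      with itself. With \<open>n\<close> entries there are at most \<open>n * n + n\<close> of them,
      which is where the number of rounds comes from.\<close>
    define C where "C = src1 ` U \<times> dst2 ` U \<union> (\<lambda>r. (src1 r, src1 r)) ` U"
    have cU: "card U \<le> length (all_edges A)"
      unfolding U_def us_def using card_length[of "rule_pairs (all_edges A)"] by simp
    have "card C \<le> card (src1 ` U) * card (dst2 ` U) + card U"
      unfolding C_def using card_image_le[of U "\<lambda>r. (src1 r, src1 r)"]
      by (intro order_trans[OF card_Un_le]) (simp add: card_cartesian_product U_def)
    also have "\<dots> \<le> card U * card U + card U"
      using card_image_le[of U] by (intro add_right_mono mult_le_mono) (simp_all add: U_def)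
    also have "\<dots> \<le> (card U + 1)\<^sup>2" by (simp add: power2_eq_square)
    also have "\<dots> \<le> (length (all_edges A) + 1)\<^sup>2" using cU by (intro power_mono) auto
    finally have cC: "card C \<le> h" using h by simp
    obtain n where n: "tree (axioms_of U) (rules_of U) ?x m n" using m(1) G by auto
    have "tree_height (axioms_of U) (rules_of U) h ?x m"
    proof (rule max_weight_tree_height[where C = C])
      show "0 \<le> k" if "(x, y, z, k) \<in> rules_of U" for x y z k
        using that nonneg by (auto simp: rules_of_def)
      show "finite C" by (simp add: C_def U_def)
      show "axioms_of U \<subseteq> C" "fst ` rules_of U \<subseteq> C"
        by (auto simp: C_def axioms_of_def rules_of_def)
      show "w \<le> m" if "tree (axioms_of U) (rules_of U) ?x w s" for w s
        using that m(2) G by blast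
    qed (fact cC n)+
    then have "m + 1 \<le> ?V ?x" using rounds_complete nonneg unfolding U_def by blast
    moreover have "?V ?x - 1 \<le> m"
    proof -
      have "0 < ?V ?x" using \<open>m + 1 \<le> ?V ?x\<close> goal_weights_pos[OF A m(1)] by simp
      then have "?V ?x - 1 \<in> goal_weights A" using sound G unfolding sound_cells_def by blast
      then show ?thesis by (rule m(2))
    qed
    ultimately show ?thesis using False unfolding us_def[symmetric] m_def[symmetric] by simp
  qed
qed

section \<open>Structured programs for the random access machine\<close>

datatype com =
    Skip
  | Basic instr
  | Seq com com  (infixr ";;" 60)
  | IfPos nat com com
  | WhilePos nat com

text \<open>
  Registers below 32 are program variables, the others form the memory, which is accessed only
  indirectly. Operands of multiplications are bounded by \<open>2 ^ B\<close>: then no other operation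
  increases the bit length by more than one, and logarithmic cost is controlled by the number of steps.
\<close>
type_synonym store = "(nat \<Rightarrow> int) \<times> (int \<Rightarrow> int) \<times> int list \<times> int list"

fun basic :: "nat \<Rightarrow> instr \<Rightarrow> store \<Rightarrow> store option" where
  "basic B (Const i c) (v, m, inp, out) =
     (if i < 32 \<and> \<bar>c\<bar> \<le> 64 then Some (v(i := c), m, inp, out) else None)"
| "basic B (Add i j k) (v, m, inp, out) =
     (if i < 32 \<and> j < 32 \<and> k < 32 then Some (v(i := v j + v k), m, inp, out) else None)"
| "basic B (Sub i j k) (v, m, inp, out) =
     (if i < 32 \<and> j < 32 \<and> k < 32 then Some (v(i := v j - v k), m, inp, out) else None)"
| "basic B (Mult i j k) (v, m, inp, out) =
     (if i < 32 \<and> j < 32 \<and> k < 32 \<and> \<bar>v j\<bar> \<le> 2 ^ B \<and> \<bar>v k\<bar> \<le> 2 ^ B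
      then Some (v(i := v j * v k), m, inp, out) else None)"
| "basic B (Load i j) (v, m, inp, out) =
     (if i < 32 \<and> j < 32 \<and> 32 \<le> v j then Some (v(i := m (v j)), m, inp, out) else None)"
| "basic B (Store i j) (v, m, inp, out) =
     (if i < 32 \<and> j < 32 \<and> 32 \<le> v i then Some (v, m(v i := v j), inp, out) else None)"
| "basic B (Read i) (v, m, inp, out) =
     (case inp of [] \<Rightarrow> None | x # inp' \<Rightarrow> if i < 32 then Some (v(i := x), m, inp', out) else None)"
| "basic B (Write i) (v, m, inp, out) = (if i < 32 then Some (v, m, inp, out @ [v i]) else None)"
| "basic B (Jump l) \<sigma> = None"
| "basic B (JumpPos j l) \<sigma> = None"

text \<open>The counts agree with the number of machine instructions that the compiled code
  executes: a failing test of \<open>IfPos\<close> costs one more jump to skip the other branch, and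
  a loop spends two jumps on each iteration and two on leaving.\<close>

inductive exec :: "nat \<Rightarrow> com \<Rightarrow> store \<Rightarrow> nat \<Rightarrow> store \<Rightarrow> bool" for B where
  Skip: "exec B Skip \<sigma> 0 \<sigma>"
| Basic: "basic B i \<sigma> = Some \<sigma>' \<Longrightarrow> exec B (Basic i) \<sigma> 1 \<sigma>'"
| Seq: "\<lbrakk>exec B c1 \<sigma> n1 \<sigma>'; exec B c2 \<sigma>' n2 \<sigma>''\<rbrakk> \<Longrightarrow> exec B (c1 ;; c2) \<sigma> (n1 + n2) \<sigma>''"
| IfTrue: "\<lbrakk>0 < fst \<sigma> j; j < 32; exec B c1 \<sigma> n \<sigma>'\<rbrakk> \<Longrightarrow> exec B (IfPos j c1 c2) \<sigma> (n + 1) \<sigma>'"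
| IfFalse: "\<lbrakk>\<not> 0 < fst \<sigma> j; j < 32; exec B c2 \<sigma> n \<sigma>'\<rbrakk> \<Longrightarrow> exec B (IfPos j c1 c2) \<sigma> (n + 2) \<sigma>'"
| WhileTrue: "\<lbrakk>0 < fst \<sigma> j; j < 32; exec B c \<sigma> n \<sigma>'; exec B (WhilePos j c) \<sigma>' n' \<sigma>''\<rbrakk>
     \<Longrightarrow> exec B (WhilePos j c) \<sigma> (n + n' + 2) \<sigma>''"
| WhileFalse: "\<lbrakk>\<not> 0 < fst \<sigma> j; j < 32\<rbrakk> \<Longrightarrow> exec B (WhilePos j c) \<sigma> 2 \<sigma>"

fun code_length :: "com \<Rightarrow> nat" where
  "code_length Skip = 0"
| "code_length (Basic i) = 1"
| "code_length (c1 ;; c2) = code_length c1 + code_length c2"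
| "code_length (IfPos j c1 c2) = code_length c1 + code_length c2 + 2"
| "code_length (WhilePos j c) = code_length c + 3"

text \<open>Jump targets are absolute, hence the load address. \<open>JumpPos\<close> falls through
  when the register is not positive, so the second branch is placed first.\<close>

fun compile :: "nat \<Rightarrow> com \<Rightarrow> ram" where
  "compile l Skip = []"
| "compile l (Basic i) = [i]"
| "compile l (c1 ;; c2) = compile l c1 @ compile (l + code_length c1) c2"
| "compile l (IfPos j c1 c2) =
     JumpPos j (l + code_length c2 + 2) # compile (l + 1) c2 @
     Jump (l + code_length c1 + code_length c2 + 2) # compile (l + code_length c2 + 2) c1"
| "compile l (WhilePos j c) =
     JumpPos j (l + 2) # Jump (l + code_length c + 3) # compile (l + 2) c @ [Jump l]"

lemma length_compile [simp]: "length (compile l c) = code_length c"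
  by (induction c arbitrary: l) auto

section \<open>Simulation by compiled code and its logarithmic cost\<close>

lemma ram_steps_trans:
  "ram_steps P c t c' \<Longrightarrow> ram_steps P c' u c'' \<Longrightarrow> ram_steps P c (t + u) c''"
proof (induction rule: ram_steps.induct)
  case (step c t c' u' d)
  from ram_steps.step[OF step.hyps(1,2) step.IH[OF step.prems]] show ?case by (simp add: add.assoc)
qed simp

lemma ram_steps_single:
  assumes "fst c < length P" "exec_instr (P ! fst c) c = Some (t, c')"
  shows "ram_steps P c t c'"
  using ram_steps.step[OF assms ram_steps.refl] by simp

definition merge :: "(nat \<Rightarrow> int) \<Rightarrow> (int \<Rightarrow> int) \<Rightarrow> nat \<Rightarrow> int" where
  "merge v m a = (if a < 32 then v a else m (int a))"

fun bits_bounded :: "nat \<Rightarrow> store \<Rightarrow> bool" where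
  "bits_bounded K (v, m, inp, out) \<longleftrightarrow>
     (\<forall>i. \<bar>v i\<bar> \<le> 2 ^ K) \<and> (\<forall>a. \<bar>m a\<bar> \<le> 2 ^ K) \<and> (\<forall>x\<in>set inp. \<bar>x\<bar> \<le> 2 ^ K)"

lemma bits_bounded_mono:
  assumes "bits_bounded K \<sigma>" "K \<le> K'"
  shows "bits_bounded K' \<sigma>"
proof -
  have "(2::int) ^ K \<le> 2 ^ K'" using assms(2) by simp
  then have "\<bar>x\<bar> \<le> 2 ^ K \<Longrightarrow> \<bar>x\<bar> \<le> 2 ^ K'" for x :: int by linarith
  then show ?thesis using assms(1) by (cases \<sigma>) simp
qed

lemma bit_size_le:
  assumes "\<bar>x\<bar> \<le> 2 ^ K"
  shows "bit_size x \<le> Suc K"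
proof -
  have "nat \<bar>x\<bar> \<le> 2 ^ K" using assms by (simp add: nat_le_iff)
  also have "\<dots> < 2 ^ (K + 1)" by simp
  finally have "floorlog 2 (nat \<bar>x\<bar>) \<le> Suc K" by (intro floorlog_leI) auto
  then show ?thesis by (simp add: bit_size_def)
qed

lemma abs_le_power_bit_size: "\<bar>x\<bar> \<le> 2 ^ bit_size x"
proof -
  have "nat \<bar>x\<bar> < 2 ^ floorlog 2 (nat \<bar>x\<bar>)" 
    by (cases "nat \<bar>x\<bar> = 0") (use floorlog_bounds[of "nat \<bar>x\<bar>" 2] in auto)
  also have "\<dots> \<le> 2 ^ bit_size x" unfolding bit_size_def by (intro power_increasing) auto
  finally show ?thesis by (simp add: nat_less_iff)
qed

text \<open>Sums and differences at most double the bound; a product of operands within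
  \<open>2 ^ B\<close> fits because \<open>2 * B \<le> K\<close>; constants are at most 64, which
  explains \<open>6 \<le> K\<close>.\<close>

lemma basic_bits_bounded:
  assumes b: "basic B i \<sigma> = Some \<sigma>'" and B: "2 * B \<le> K" "6 \<le> K" and bd: "bits_bounded K \<sigma>"
  shows "bits_bounded (Suc K) \<sigma>'"
proof -
  obtain v m inp out where \<sigma>: "\<sigma> = (v, m, inp, out)" by (metis prod_cases4)
  have mono: "\<bar>x\<bar> \<le> 2 ^ Suc K" if "\<bar>x\<bar> \<le> 2 ^ K" for x :: int using that by simp
  have add: "\<bar>x + y\<bar> \<le> 2 ^ Suc K" "\<bar>x - y\<bar> \<le> 2 ^ Suc K" if "\<bar>x\<bar> \<le> 2 ^ K" "\<bar>y\<bar> \<le> 2 ^ K" for x y :: int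
    using that by simp_all
  have mult: "\<bar>x * y\<bar> \<le> 2 ^ Suc K" if "\<bar>x\<bar> \<le> 2 ^ B" "\<bar>y\<bar> \<le> 2 ^ B" for x y :: int
  proof -
    have "\<bar>x * y\<bar> \<le> 2 ^ B * 2 ^ B" unfolding abs_mult using that by (intro mult_mono) auto
    also have "\<dots> = 2 ^ (2 * B)" by (simp add: mult_2 power_add)
    also have "\<dots> \<le> 2 ^ Suc K" using B(1) by (intro power_increasing) auto
    finally show ?thesis .
  qed
  have const: "\<bar>c\<bar> \<le> 2 ^ Suc K" if "\<bar>c\<bar> \<le> 64" for c :: int
  proof -
    have "(2::int) ^ 6 \<le> 2 ^ Suc K" using B(2) by (intro power_increasing) auto
    then show ?thesis using that by simp
  qed
  have bd: "\<And>i. \<bar>v i\<bar> \<le> 2 ^ K" "\<And>a. \<bar>m a\<bar> \<le> 2 ^ K" "\<And>x. x \<in> set inp \<Longrightarrow> \<bar>x\<bar> \<le> 2 ^ K"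
    using bd \<sigma> by auto
  note bd' = bd[THEN mono]
  have upd: "bits_bounded (Suc K) (v(r := x), m, inp, out)" if "\<bar>x\<bar> \<le> 2 ^ Suc K" for r x
    using that bd' by (simp del: power_Suc)
  have old: "bits_bounded (Suc K) (v, m, inp, out')" for out'
    using bd' by (simp del: power_Suc)
  show ?thesis
  proof (cases i)
    case (Const r c)
    then show ?thesis using b upd[OF const] unfolding \<sigma> by (auto simp del: power_Suc bits_bounded.simps split: if_splits)
  next
    case (Add r j k)
    then show ?thesis using b upd[OF add(1)[OF bd(1) bd(1)]] unfolding \<sigma>
      by (auto simp del: power_Suc bits_bounded.simps split: if_splits)
  next
    case (Sub r j k)
    then show ?thesis using b upd[OF add(2)[OF bd(1) bd(1)]] unfolding \<sigma>
      by (auto simp del: power_Suc bits_bounded.simps split: if_splits)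
  next
    case (Mult r j k)
    then show ?thesis using b upd[OF mult] unfolding \<sigma>
      by (auto simp del: power_Suc bits_bounded.simps split: if_splits)
  next
    case (Load r j)
    then show ?thesis using b upd[OF bd'(2)] unfolding \<sigma>
      by (auto simp del: power_Suc bits_bounded.simps split: if_splits)
  next
    case (Store r j)
    then have "\<sigma>' = (v, m(v r := v j), inp, out)" using b unfolding \<sigma> by (auto split: if_splits)
    then show ?thesis using bd' by (simp del: power_Suc)
  next
    case (Read r)
    then obtain x inp' where "inp = x # inp'" "\<sigma>' = (v(r := x), m, inp', out)"
      using b unfolding \<sigma> by (auto split: list.splits if_splits)
    then show ?thesis using bd' by (simp del: power_Suc)
  next
    case (Write r)
    then show ?thesis using b old unfolding \<sigma>
      by (auto simp del: power_Suc bits_bounded.simps split: if_splits)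
  qed (use b in simp_all)
qed

text \<open>Every basic instruction reads at most two registers.\<close>
lemma basic_exec_instr:
  assumes b: "basic B i (v, m, inp, out) = Some \<sigma>'" and B: "6 \<le> K"
    and bd: "bits_bounded K (v, m, inp, out)"
  shows "\<exists>t. exec_instr i (pc, merge v m, inp, out) = Some (t, (case \<sigma>' of (v', m', inp', out') \<Rightarrow> (Suc pc, merge v' m', inp', out'))) \<and>
    t \<le> 2 * K + 2"
proof -
  have bs: "bit_size (v j) \<le> K + 1" "bit_size (m a) \<le> K + 1" for j a
    using bd by (auto intro: bit_size_le)
  have bi: "bit_size x \<le> 2 * K + 2" if "x \<in> set inp" for x
  proof -
    have "\<bar>x\<bar> \<le> 2 ^ K" using bd that by simp
    from bit_size_le[OF this] show ?thesis by simp
  qed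
  have bc: "bit_size c \<le> 2 * K + 2" if "\<bar>c\<bar> \<le> 64" for c
  proof -
    have "(2::int) ^ 6 \<le> 2 ^ K" using B by (intro power_increasing) auto
    then have "\<bar>c\<bar> \<le> 2 ^ K" using that by simp
    from bit_size_le[OF this] show ?thesis by simp
  qed
  have two: "bit_size (v j) + bit_size (v k) \<le> 2 * K + 2" "bit_size (v j) + bit_size (m a) \<le> 2 * K + 2" for j k a
    using bs(1)[of j] bs(1)[of k] bs(2)[of a] by linarith+
  have one: "bit_size (v j) \<le> 2 * K + 2" for j
    using bs(1)[of j] by linarith
  have upd: "(merge v m)(j := x) = merge (v(j := x)) m" if "j < 32" for j x
    using that by (auto simp: merge_def fun_eq_iff)
  have updm: "(merge v m)(nat a := x) = merge v (m(a := x))" if "32 \<le> a" for a x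
    using that by (auto simp: merge_def fun_eq_iff)
  have low: "merge v m j = v j" if "j < 32" for j using that by (simp add: merge_def)
  have high: "merge v m (nat a) = m a" if "32 \<le> a" for a using that by (auto simp: merge_def nat_less_iff)
  show ?thesis
    using b
    by (cases i) (auto simp: upd updm low high two[simplified] one[simplified] bc[simplified] bi[simplified]
        split: if_splits list.splits)
qed

text \<open>Within \<open>n\<close> steps all values stay in the range of
  \<open>2 ^ (K + n)\<close>, so each step costs at most two bit sizes of \<open>K + n + 1\<close>;
  the cost is thus quadratic in \<open>n\<close>. The code is placed between arbitrary
  \<open>pre\<close> and \<open>post\<close> because subprograms are located by the length of what
  precedes them.\<close>

lemma compile_correct:
  "exec B c \<sigma> n \<sigma>' \<Longrightarrow> 2 * B \<le> K \<Longrightarrow> 6 \<le> K \<Longrightarrow> bits_bounded K \<sigma> \<Longrightarrow>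
   P = pre @ compile (length pre) c @ post \<Longrightarrow> \<sigma> = (v, m, inp, out) \<Longrightarrow> \<sigma>' = (v', m', inp', out') \<Longrightarrow>
   (\<exists>t. ram_steps P (length pre, merge v m, inp, out) t
        (length pre + code_length c, merge v' m', inp', out') \<and> t \<le> n * (2 * (K + n) + 2)) \<and>
   bits_bounded (K + n) \<sigma>'"
proof (induction arbitrary: K pre post v m inp out v' m' inp' out' rule: exec.induct)
  case (Skip \<sigma>)
  then show ?case by (auto intro: ram_steps.refl)
next
  case (Basic i \<sigma> \<sigma>')
  then obtain t where t: "exec_instr i (length pre, merge v m, inp, out) =
      Some (t, (Suc (length pre), merge v' m', inp', out'))" "t \<le> 2 * K + 2"
    using basic_exec_instr[of B i v m inp out \<sigma>' K "length pre"] by auto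
  have "ram_steps P (length pre, merge v m, inp, out) t (length pre + 1, merge v' m', inp', out')"
    using Basic.prems t by (intro ram_steps_single) (auto simp: nth_append)
  then show ?case using t(2) basic_bits_bounded[OF Basic.hyps Basic.prems(1-3)] by auto
next
  case (Seq c1 \<sigma> n1 \<sigma>1 c2 n2 \<sigma>')
  obtain v1 m1 inp1 out1 where s1: "\<sigma>1 = (v1, m1, inp1, out1)" by (metis prod_cases4)
  obtain t1 where t1: "ram_steps P (length pre, merge v m, inp, out) t1
      (length pre + code_length c1, merge v1 m1, inp1, out1)" "t1 \<le> n1 * (2 * (K + n1) + 2)"
    and b1: "bits_bounded (K + n1) \<sigma>1"
    using Seq.IH(1)[OF Seq.prems(1-3) _ Seq.prems(5) s1, of pre "compile (length pre + code_length c1) c2 @ post"]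
      Seq.prems(4) by auto
  obtain t2 where t2: "ram_steps P (length pre + code_length c1, merge v1 m1, inp1, out1) t2
      (length pre + code_length c1 + code_length c2, merge v' m', inp', out')"
      "t2 \<le> n2 * (2 * (K + n1 + n2) + 2)"
    and b2: "bits_bounded (K + n1 + n2) \<sigma>'"
    using Seq.IH(2)[OF _ _ b1 _ s1 Seq.prems(6), of "pre @ compile (length pre) c1" post]
      Seq.prems(1,2,4) by auto
  have "t1 + t2 \<le> n1 * (2 * (K + (n1 + n2)) + 2) + n2 * (2 * (K + (n1 + n2)) + 2)"
    using t1(2) t2(2) by (intro add_mono) (auto elim!: order_trans intro!: mult_le_mono2 simp: add.assoc)
  also have "\<dots> = (n1 + n2) * (2 * (K + (n1 + n2)) + 2)" by (simp add: algebra_simps)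
  finally show ?case using ram_steps_trans[OF t1(1) t2(1)] b2 by (auto simp: add.assoc)
next
  case (IfTrue \<sigma> j c1 n \<sigma>' c2)
  let ?pre = "pre @ JumpPos j (length pre + code_length c2 + 2) # compile (length pre + 1) c2 @
    [Jump (length pre + code_length c1 + code_length c2 + 2)]"
  obtain t where t: "ram_steps P (length ?pre, merge v m, inp, out) t
      (length ?pre + code_length c1, merge v' m', inp', out')" "t \<le> n * (2 * (K + n) + 2)"
    and b: "bits_bounded (K + n) \<sigma>'"
    using IfTrue.IH[OF IfTrue.prems(1-3) _ IfTrue.prems(5,6), of ?pre post] IfTrue.prems(4) by auto
  have "bit_size (v j) \<le> K + 1" using IfTrue.prems(3,5) bit_size_le[of "v j" K] by simp
  moreover have "ram_steps P (length pre, merge v m, inp, out) (bit_size (v j))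
    (length ?pre, merge v m, inp, out)"
    using IfTrue.prems IfTrue.hyps
    by (intro ram_steps_single) (auto simp: nth_append merge_def)
  moreover have "bit_size (v j) + t \<le> (n + 1) * (2 * (K + (n + 1)) + 2)"
    using t(2) \<open>bit_size (v j) \<le> K + 1\<close> by (simp add: algebra_simps)
  ultimately show ?case using t(1) bits_bounded_mono[OF b]
    by (auto intro!: exI[of _ "bit_size (v j) + t"] elim!: ram_steps_trans simp: algebra_simps)
next
  case (IfFalse \<sigma> j c2 n \<sigma>' c1)
  let ?pre = "pre @ [JumpPos j (length pre + code_length c2 + 2)]"
  let ?post = "Jump (length pre + code_length c1 + code_length c2 + 2) #
    compile (length pre + code_length c2 + 2) c1 @ post"
  obtain t where t: "ram_steps P (length ?pre, merge v m, inp, out) t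
      (length ?pre + code_length c2, merge v' m', inp', out')" "t \<le> n * (2 * (K + n) + 2)"
    and b: "bits_bounded (K + n) \<sigma>'"
    using IfFalse.IH[OF IfFalse.prems(1-3) _ IfFalse.prems(5,6), of ?pre ?post] IfFalse.prems(4) by auto
  have "bit_size (v j) \<le> K + 1" using IfFalse.prems(3,5) bit_size_le[of "v j" K] by simp
  have 1: "ram_steps P (length pre, merge v m, inp, out) (bit_size (v j))
    (length ?pre, merge v m, inp, out)"
    using IfFalse.prems IfFalse.hyps
    by (intro ram_steps_single) (auto simp: nth_append merge_def)
  have 2: "ram_steps P (length ?pre + code_length c2, merge v' m', inp', out') 1
    (length pre + code_length (IfPos j c1 c2), merge v' m', inp', out')"
    using IfFalse.prems by (intro ram_steps_single) (auto simp: nth_append)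
  have "bit_size (v j) + (t + 1) \<le> (n + 2) * (2 * (K + (n + 2)) + 2)"
    using t(2) \<open>bit_size (v j) \<le> K + 1\<close> by (simp add: algebra_simps)
  then show ?case using ram_steps_trans[OF 1 ram_steps_trans[OF t(1) 2]] bits_bounded_mono[OF b, of "K + (n + 2)"]
    by auto
next
  case (WhileTrue \<sigma> j c n \<sigma>1 n' \<sigma>')
  obtain v1 m1 inp1 out1 where s1: "\<sigma>1 = (v1, m1, inp1, out1)" by (metis prod_cases4)
  let ?pre = "pre @ [JumpPos j (length pre + 2), Jump (length pre + code_length c + 3)]"
  obtain t where t: "ram_steps P (length ?pre, merge v m, inp, out) t
      (length ?pre + code_length c, merge v1 m1, inp1, out1)" "t \<le> n * (2 * (K + n) + 2)"
    and b: "bits_bounded (K + n) \<sigma>1"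
    using WhileTrue.IH(1)[OF WhileTrue.prems(1-3) _ WhileTrue.prems(5) s1, of ?pre "Jump (length pre) # post"]
      WhileTrue.prems(4) by auto
  obtain t' where t': "ram_steps P (length pre, merge v1 m1, inp1, out1) t'
      (length pre + code_length (WhilePos j c), merge v' m', inp', out')" "t' \<le> n' * (2 * (K + n + n') + 2)"
    and b': "bits_bounded (K + n + n') \<sigma>'"
    using WhileTrue.IH(2)[OF _ _ b WhileTrue.prems(4) s1 WhileTrue.prems(6)] WhileTrue.prems(1,2) by auto
  have "bit_size (v j) \<le> K + 1" using WhileTrue.prems(3,5) bit_size_le[of "v j" K] by simp
  have 1: "ram_steps P (length pre, merge v m, inp, out) (bit_size (v j))
    (length ?pre, merge v m, inp, out)"
    using WhileTrue.prems WhileTrue.hyps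
    by (intro ram_steps_single) (auto simp: nth_append merge_def)
  have 2: "ram_steps P (length ?pre + code_length c, merge v1 m1, inp1, out1) 1
    (length pre, merge v1 m1, inp1, out1)"
    using WhileTrue.prems by (intro ram_steps_single) (auto simp: nth_append)
  have "bit_size (v j) + (t + (1 + t')) \<le> (n + n' + 2) * (2 * (K + (n + n' + 2)) + 2)"
    using t(2) t'(2) \<open>bit_size (v j) \<le> K + 1\<close> by (simp add: algebra_simps)
  then show ?case
    using ram_steps_trans[OF 1 ram_steps_trans[OF t(1) ram_steps_trans[OF 2 t'(1)]]]
      bits_bounded_mono[OF b', of "K + (n + n' + 2)"]
    by auto
next
  case (WhileFalse \<sigma> j c)
  have "bit_size (v j) \<le> K + 1" using WhileFalse.prems(3,5) bit_size_le[of "v j" K] by simp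
  have 1: "ram_steps P (length pre, merge v m, inp, out) (bit_size (v j))
    (length pre + 1, merge v m, inp, out)"
    using WhileFalse.prems WhileFalse.hyps
    by (intro ram_steps_single) (auto simp: nth_append merge_def)
  have 2: "ram_steps P (length pre + 1, merge v m, inp, out) 1
    (length pre + code_length (WhilePos j c), merge v m, inp, out)"
    using WhileFalse.prems by (intro ram_steps_single) (auto simp: nth_append)
  have "bit_size (v j) + 1 \<le> 2 * (2 * (K + 2) + 2)"
    using \<open>bit_size (v j) \<le> K + 1\<close> by simp
  then show ?case using ram_steps_trans[OF 1 2] WhileFalse.prems bits_bounded_mono[OF WhileFalse.prems(3), of "K + 2"]
    by auto
qed

corollary compile_outputs:
  assumes "exec B c (\<lambda>_. 0, \<lambda>_. 0, inp, []) n (v, m, rest, out)" "2 * B \<le> K" "6 \<le> K"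
    "\<forall>x\<in>set inp. \<bar>x\<bar> \<le> 2 ^ K"
  shows "\<exists>t \<le> n * (2 * (K + n) + 2). ram_outputs (compile 0 c) inp out t"
proof -
  have "merge (\<lambda>_. 0) (\<lambda>_. 0) = (\<lambda>_. 0)" by (auto simp: merge_def)
  with compile_correct[OF assms(1-3), of "compile 0 c" "[]" "[]"] assms(4)
  show ?thesis unfolding ram_outputs_def by fastforce
qed

definition wp :: "nat \<Rightarrow> com \<Rightarrow> nat \<Rightarrow> (store \<Rightarrow> bool) \<Rightarrow> store \<Rightarrow> bool" where
  "wp B c N Q \<sigma> \<longleftrightarrow> (\<exists>n \<sigma>'. exec B c \<sigma> n \<sigma>' \<and> n \<le> N \<and> Q \<sigma>')"

lemma wp_mono: "wp B c N Q \<sigma> \<Longrightarrow> (\<And>\<sigma>'. Q \<sigma>' \<Longrightarrow> Q' \<sigma>') \<Longrightarrow> N \<le> N' \<Longrightarrow> wp B c N' Q' \<sigma>"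
  unfolding wp_def by (meson le_trans)

lemma wp_Seq: "wp B c1 N1 (wp B c2 N2 Q) \<sigma> \<Longrightarrow> wp B (c1 ;; c2) (N1 + N2) Q \<sigma>"
  unfolding wp_def by (meson add_mono exec.Seq)

text \<open>Recursion on the program turns symbolic execution into rewriting. Loop-free code runs
  each instruction at most once, so \<open>code_length\<close> serves as its step budget.\<close>

fun loop_free_wp :: "nat \<Rightarrow> com \<Rightarrow> (store \<Rightarrow> bool) \<Rightarrow> store \<Rightarrow> bool" where
  "loop_free_wp B Skip Q \<sigma> = Q \<sigma>"
| "loop_free_wp B (Basic i) Q \<sigma> = (case basic B i \<sigma> of None \<Rightarrow> False | Some \<sigma>' \<Rightarrow> Q \<sigma>')"
| "loop_free_wp B (c1 ;; c2) Q \<sigma> = loop_free_wp B c1 (loop_free_wp B c2 Q) \<sigma>"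
| "loop_free_wp B (IfPos j c1 c2) Q \<sigma> = (j < 32 \<and> (if 0 < fst \<sigma> j then loop_free_wp B c1 Q \<sigma> else loop_free_wp B c2 Q \<sigma>))"
| "loop_free_wp B (WhilePos j c) Q \<sigma> = False"

lemma wp_loop_free: "loop_free_wp B c Q \<sigma> \<Longrightarrow> wp B c (code_length c) Q \<sigma>"
proof (induction c arbitrary: Q \<sigma>)
  case Skip
  then show ?case unfolding wp_def by (simp only: loop_free_wp.simps) (blast intro: exec.Skip le0)
next
  case (Basic i)
  then obtain \<sigma>' where "basic B i \<sigma> = Some \<sigma>'" "Q \<sigma>'" by (auto split: option.splits)
  then show ?case unfolding wp_def by (intro exI[of _ 1] exI[of _ \<sigma>']) (auto intro: exec.Basic simp del: One_nat_def)
next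
  case (Seq c1 c2)
  then have "wp B c1 (code_length c1) (loop_free_wp B c2 Q) \<sigma>" by simp
  then have "wp B c1 (code_length c1) (wp B c2 (code_length c2) Q) \<sigma>"
    by (rule wp_mono) (auto intro: Seq.IH)
  then show ?case by (auto intro: wp_Seq)
next
  case (IfPos j c1 c2)
  show ?case
  proof (cases "0 < fst \<sigma> j")
    case True
    then have "wp B c1 (code_length c1) Q \<sigma>" using IfPos by simp
    then obtain n \<sigma>' where "exec B c1 \<sigma> n \<sigma>'" "n \<le> code_length c1" "Q \<sigma>'" by (auto simp: wp_def)
    then show ?thesis unfolding wp_def using IfPos.prems True
      by (intro exI[of _ "n + 1"] exI[of _ \<sigma>']) (auto intro: exec.IfTrue[of \<sigma> j B c1 n, simplified])
  next
    case False
    then have "wp B c2 (code_length c2) Q \<sigma>" using IfPos by simp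
    then obtain n \<sigma>' where "exec B c2 \<sigma> n \<sigma>'" "n \<le> code_length c2" "Q \<sigma>'" by (auto simp: wp_def)
    then show ?thesis unfolding wp_def using IfPos.prems False
      by (intro exI[of _ "n + 2"] exI[of _ \<sigma>']) (auto intro: exec.IfFalse[of \<sigma> j B c2 n, simplified])
  qed
qed simp

text \<open>The number \<open>k\<close> of iterations is fixed in advance and the invariant is
  indexed by the iteration, which yields termination and the step budget together.\<close>

lemma wp_WhilePos:
  assumes step: "\<And>i \<sigma>. i < k \<Longrightarrow> I i \<sigma> \<Longrightarrow> wp B c N (I (Suc i)) \<sigma>"
    and pos: "\<And>i \<sigma>. i < k \<Longrightarrow> I i \<sigma> \<Longrightarrow> 0 < fst \<sigma> j"
    and stop: "\<And>\<sigma>. I k \<sigma> \<Longrightarrow> \<not> 0 < fst \<sigma> j"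
    and "I 0 \<sigma>" "j < 32"
  shows "wp B (WhilePos j c) (k * (N + 2) + 2) (I k) \<sigma>"
proof -
  have "wp B (WhilePos j c) ((k - i) * (N + 2) + 2) (I k) \<sigma>" if "i \<le> k" "I i \<sigma>" for i \<sigma>
    using that
  proof (induction "k - i" arbitrary: i \<sigma>)
    case 0
    then have "i = k" by simp
    then have "exec B (WhilePos j c) \<sigma> 2 \<sigma>" using 0 stop \<open>j < 32\<close> by (intro exec.WhileFalse) blast+
    then show ?case using 0 \<open>i = k\<close> unfolding wp_def by (intro exI[of _ 2] exI[of _ \<sigma>]) simp
  next
    case (Suc d)
    then have i: "i < k" "d = k - Suc i" by auto
    obtain n \<sigma>' where n: "exec B c \<sigma> n \<sigma>'" "n \<le> N" "I (Suc i) \<sigma>'"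
      using step[OF i(1) Suc.prems(2)] by (auto simp: wp_def)
    obtain n' \<sigma>'' where n': "exec B (WhilePos j c) \<sigma>' n' \<sigma>''" "n' \<le> d * (N + 2) + 2" "I k \<sigma>''"
      using Suc.hyps(1)[OF i(2) _ n(3)] i by (auto simp: wp_def)
    have "exec B (WhilePos j c) \<sigma> (n + n' + 2) \<sigma>''"
      using exec.WhileTrue[OF pos[OF i(1) Suc.prems(2)] \<open>j < 32\<close> n(1) n'(1)] .
    moreover have "n + n' + 2 \<le> (k - i) * (N + 2) + 2"
      using n(2) n'(2) Suc.hyps(2)[symmetric] by simp
    ultimately show ?case using n'(3) unfolding wp_def by blast
  qed
  from this[of 0 \<sigma>] show ?thesis using assms(4) by simp
qed

section \<open>The program\<close>

abbreviation (input) "rZero \<equiv> 0 :: nat"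
abbreviation (input) "rOne \<equiv> Suc 0"
abbreviation (input) "rDim \<equiv> 2 :: nat"
abbreviation (input) "rCount \<equiv> 3 :: nat"
abbreviation (input) "rPtr \<equiv> 4 :: nat"
abbreviation (input) "rStart \<equiv> 5 :: nat"
abbreviation (input) "rGoal \<equiv> 6 :: nat"
abbreviation (input) "rLoop \<equiv> 7 :: nat"

section \<open>Building the table of rule pairs from the input\<close>

definition pair_at :: "(int \<Rightarrow> int) \<Rightarrow> int \<Rightarrow> rule_pair \<Rightarrow> bool" where
  "pair_at m a r \<longleftrightarrow> m a = src1 r \<and> m (a + 1) = dst1 r \<and> m (a + 2) = wt1 r \<and> m (a + 3) = sym1 r \<and>
     m (a + 4) = src2 r \<and> m (a + 5) = dst2 r \<and> m (a + 6) = wt2 r \<and> m (a + 7) = sym2 r"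

definition stored :: "(int \<Rightarrow> int) \<Rightarrow> edge list \<Rightarrow> bool" where
  "stored m es \<longleftrightarrow> (\<forall>i<length es. pair_at m (32 + 8 * int i) (rule_pairs es ! i))"

definition dim_ok :: "int \<Rightarrow> edge list \<Rightarrow> bool" where
  "dim_ok D es \<longleftrightarrow> 32 + 8 * int (length es) < D \<and>
     (\<forall>(p, q, w, opr)\<in>set es. 0 \<le> p \<and> p < D \<and> 0 \<le> q \<and> q < D)"

fun op_code :: "nat stack_op \<Rightarrow> int" where
  "op_code NoOp = 0" | "op_code (Push a) = 1" | "op_code (Pop a) = 2"

fun op_arg :: "nat stack_op \<Rightarrow> int" where
  "op_arg NoOp = 0" | "op_arg (Push a) = int a" | "op_arg (Pop a) = int a"

text \<open>
  Stores the pair for the edge given by registers 8 to 12. Registers 13 to 20 hold its components.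
\<close>
definition emit :: com where
  "emit =
    Basic (Sub 21 rZero rPtr) ;; Basic (Add 13 8 rZero) ;;
    IfPos 11
      (Basic (Sub 22 11 rOne) ;;
       IfPos 22
         (Basic (Add 14 8 rZero) ;; Basic (Const 15 0) ;; Basic (Add 16 21 rZero) ;; Basic (Add 17 8 rZero) ;;
          Basic (Add 18 9 rZero) ;; Basic (Add 19 10 rZero) ;; Basic (Add 20 12 rZero))
         (Basic (Add 14 9 rZero) ;; Basic (Add 15 10 rZero) ;; Basic (Add 16 12 rZero) ;; Basic (Const 17 0) ;;
          Basic (Const 18 0) ;; Basic (Const 19 0) ;; Basic (Add 20 12 rZero)))
      (Basic (Add 14 8 rZero) ;; Basic (Add 15 10 rZero) ;; Basic (Add 16 21 rZero) ;; Basic (Add 17 8 rZero) ;;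
       Basic (Add 18 9 rZero) ;; Basic (Const 19 0) ;; Basic (Add 20 21 rZero)) ;;
    Basic (Store rPtr 13) ;; Basic (Add rPtr rPtr rOne) ;;
    Basic (Store rPtr 14) ;; Basic (Add rPtr rPtr rOne) ;;
    Basic (Store rPtr 15) ;; Basic (Add rPtr rPtr rOne) ;;
    Basic (Store rPtr 16) ;; Basic (Add rPtr rPtr rOne) ;;
    Basic (Store rPtr 17) ;; Basic (Add rPtr rPtr rOne) ;;
    Basic (Store rPtr 18) ;; Basic (Add rPtr rPtr rOne) ;;
    Basic (Store rPtr 19) ;; Basic (Add rPtr rPtr rOne) ;;
    Basic (Store rPtr 20) ;; Basic (Add rPtr rPtr rOne) ;;
    Basic (Add rDim rDim 8) ;; Basic (Add rDim rDim 9) ;; Basic (Const 22 8) ;; Basic (Add rDim rDim 22) ;;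
    Basic (Add rCount rCount rOne)"

text \<open>Memory beyond the table is required to be 0, which later reads as the initial state of
  the cells: nothing derivable yet.\<close>

definition reading :: "edge list \<Rightarrow> (nat \<Rightarrow> int) \<Rightarrow> (int \<Rightarrow> int) \<Rightarrow> bool" where
  "reading es v m \<longleftrightarrow> v rZero = 0 \<and> v rOne = 1 \<and> v rPtr = 32 + 8 * int (length es) \<and>
     v rCount = int (length es) \<and> dim_ok (v rDim) es \<and> stored m es \<and>
     (\<forall>a \<ge> 32 + 8 * int (length es). m a = 0)"

lemma stored_snoc:
  assumes "stored m es" "\<And>a. a < 32 + 8 * int (length es) \<Longrightarrow> m' a = m a"
    "pair_at m' (32 + 8 * int (length es)) (rule_pair_of (- (32 + 8 * int (length es))) e)"
  shows "stored m' (es @ [e])"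
  unfolding stored_def
proof (intro allI impI)
  fix i assume i: "i < length (es @ [e])"
  show "pair_at m' (32 + 8 * int i) (rule_pairs (es @ [e]) ! i)"
  proof (cases "i < length es")
    case True
    then have "8 * int i + 8 \<le> 8 * int (length es)" by linarith
    then show ?thesis using True assms(1,2) unfolding stored_def rule_pairs_snoc
      by (simp add: nth_append pair_at_def)
  next
    case False
    then have "i = length es" using i by simp
    then show ?thesis using assms(3) by (simp add: rule_pairs_snoc nth_append)
  qed
qed

lemma emit_correct:
  assumes r: "reading es v m" and e: "v 8 = p" "v 9 = q" "v 10 = w" "v 11 = op_code opr" "v 12 = op_arg opr"
    and pq: "0 \<le> p" "0 \<le> q"
  shows "loop_free_wp B emit (\<lambda>(v', m', inp', out'). reading (es @ [(p, q, w, opr)]) v' m' \<and>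
    (\<forall>i \<in> {5, 6, 7, 10, 11, 12, 24, 25}. v' i = v i) \<and> inp' = inp \<and> out' = out) (v, m, inp, out)"
proof -
  have v: "v 0 = 0" "v (Suc 0) = 1" "v 4 = 32 + 8 * int (length es)" "v 3 = int (length es)"
    using r by (auto simp: reading_def)
  \<comment> \<open>The dimension grows by \<open>p + q + 8\<close>. A sum in place of a maximum
    avoids comparisons, dominates both nodes and leaves room for the eight new addresses.\<close>
  have dim: "dim_ok (v 2 + p + q + 8) (es @ [(p, q, w, opr)])"
    using r pq unfolding reading_def dim_ok_def by fastforce
  have zero: "m a = 0" if "32 + 8 * int (length es) \<le> a" for a using r that by (simp add: reading_def)
  have st: "stored m es" using r by (simp add: reading_def)
  show ?thesis
    by (cases opr)
      (use v e dim zero in \<open>auto simp: emit_def reading_def pair_at_def intro!: stored_snoc[OF st]\<close>)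
qed

lemma loop_free_wp_mono: "loop_free_wp B c Q \<sigma> \<Longrightarrow> (\<And>\<sigma>'. Q \<sigma>' \<Longrightarrow> Q' \<sigma>') \<Longrightarrow> loop_free_wp B c Q' \<sigma>"
proof (induction c arbitrary: Q Q' \<sigma>)
  case (Seq c1 c2)
  show ?case unfolding loop_free_wp.simps
    by (rule Seq.IH(1)[OF Seq.prems(1)[unfolded loop_free_wp.simps]]) (rule Seq.IH(2)[OF _ Seq.prems(2)])
next
  case (IfPos j c1 c2)
  then show ?case by (simp split: if_splits) blast+
qed (auto split: option.splits)

text \<open>Registers 8 and 9 are built up as twice the state plus one plus the phase. The sign test
  fixes the phases of the first edge and replaces a negative update by 0, so that register 10 holds
  \<open>max z 0\<close> for both edges.\<close>

definition read_transition :: com where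
  "read_transition =
    Basic (Read 24) ;; Basic (Read 25) ;; Basic (Read 10) ;; Basic (Read 11) ;; Basic (Read 12) ;;
    Basic (Add 8 24 24) ;; Basic (Add 8 8 rOne) ;; Basic (Add 9 25 25) ;; Basic (Add 9 9 rOne) ;;
    IfPos 10 (Basic (Add 9 9 rOne))
      (Basic (Sub 21 rZero 10) ;;
       IfPos 21 (Basic (Add 8 8 rOne) ;; Basic (Add 9 9 rOne) ;; Basic (Const 10 0)) Skip) ;;
    emit ;;
    Basic (Add 8 24 24) ;; Basic (Add 8 8 rOne) ;; Basic (Add 8 8 rOne) ;;
    Basic (Add 9 25 25) ;; Basic (Add 9 9 rOne) ;; Basic (Add 9 9 rOne) ;;
    emit ;;
    Basic (Sub rLoop rLoop rOne)"

definition encode_transition :: "nat \<times> nat \<times> int \<times> nat stack_op \<Rightarrow> int list" where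
  "encode_transition = (\<lambda>(s, s', z, opr). [int s, int s', z] @ encode_op opr)"

lemma encode_op_eq: "encode_op opr = [op_code opr, op_arg opr]"
  by (cases opr) simp_all

lemma read_transition_correct:
  assumes r: "reading es v m" and inp: "inp = encode_transition t @ rest"
  shows "loop_free_wp B read_transition (\<lambda>(v', m', inp', out'). reading (es @ edges_of t) v' m' \<and>
    v' rStart = v rStart \<and> v' rGoal = v rGoal \<and> v' rLoop = v rLoop - 1 \<and> inp' = rest \<and> out' = out) (v, m, inp, out)"
proof -
  obtain s s' z opr where t: "t = (s, s', z, opr)" by (metis prod_cases4)
  define es1 where "es1 = es @ [(node s (z < 0), node s' (z \<noteq> 0), max z 0, opr)]"
  have es2: "es @ edges_of t = es1 @ [(node s True, node s' True, max z 0, opr)]"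
    by (simp add: t es1_def)
  have rd: "reading es v m \<Longrightarrow> (\<And>i. i \<in> {0, 1, 2, 3, 4} \<Longrightarrow> v' i = v i) \<Longrightarrow> reading es v' m" for es v v' m
    by (simp add: reading_def)
  have v: "v 0 = 0" "v (Suc 0) = 1" using r by (auto simp: reading_def)
  define Q where "Q = (\<lambda>(v', m', inp', out'). reading (es @ edges_of t) v' m' \<and>
    v' rStart = v rStart \<and> v' rGoal = v rGoal \<and> v' rLoop = v rLoop - 1 \<and> inp' = rest \<and> out' = out)"
  have Q: "Q (v', m', rest, out) \<longleftrightarrow> reading (es @ edges_of t) v' m' \<and>
    v' rStart = v rStart \<and> v' rGoal = v rGoal \<and> v' rLoop = v rLoop - 1" for v' m'
    by (simp add: Q_def)
  define c2 where "c2 = Basic (Add 8 24 24) ;; Basic (Add 8 8 rOne) ;; Basic (Add 8 8 rOne) ;;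
    Basic (Add 9 25 25) ;; Basic (Add 9 9 rOne) ;; Basic (Add 9 9 rOne) ;; emit ;; Basic (Sub rLoop rLoop rOne)"
  have second: "loop_free_wp B c2 Q (v1, m1, rest, out)"
    if r1: "reading es1 v1 m1"
      and e: "v1 24 = int s" "v1 25 = int s'" "v1 10 = max z 0" "v1 11 = op_code opr" "v1 12 = op_arg opr"
      and same: "v1 rStart = v rStart" "v1 rGoal = v rGoal" "v1 rLoop = v rLoop" for v1 m1
  proof -
    have v1: "v1 0 = 0" "v1 (Suc 0) = 1" using r1 by (auto simp: reading_def)
    define v2 where "v2 = v1(8 := node s True, 9 := node s' True)"
    have r2: "reading es1 v2 m1" unfolding v2_def by (rule rd[OF r1]) auto
    have e2: "v2 8 = node s True" "v2 9 = node s' True" "v2 10 = max z 0" "v2 11 = op_code opr" "v2 12 = op_arg opr"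
      using e by (simp_all add: v2_def)
    have pos: "0 \<le> node s True" "0 \<le> node s' True" by (simp_all add: node_def)
    have "loop_free_wp B emit (loop_free_wp B (Basic (Sub rLoop rLoop rOne)) Q) (v2, m1, rest, out)"
      by (rule loop_free_wp_mono[OF emit_correct[OF r2 e2 pos]])
        (use same in \<open>auto simp: es2 v2_def reading_def Q\<close>)
    moreover have "v1(8 := int s + int s + 1 + 1, 9 := int s' + int s' + 1 + 1) = v2"
      by (simp add: v2_def node_def)
    ultimately show ?thesis using e v1 by (simp add: c2_def)
  qed
  define v2 where "v2 = v(24 := int s, 25 := int s', 10 := max z 0, 11 := op_code opr, 12 := op_arg opr,
    8 := node s (z < 0), 9 := node s' (z \<noteq> 0))"
  define c where "c = emit ;; c2"
  \<comment> \<open>Register 21 is scratch and the branches leave different values in it; excluding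
    it lets one fact serve all of them.\<close>
  have first: "loop_free_wp B c Q (v3, m, rest, out)"
    if v3: "\<And>i. i \<noteq> 21 \<Longrightarrow> v3 i = v2 i" for v3
  proof -
    have r3: "reading es v3 m" by (rule rd[OF r]) (auto simp: v3 v2_def)
    have e3: "v3 8 = node s (z < 0)" "v3 9 = node s' (z \<noteq> 0)" "v3 10 = max z 0"
      "v3 11 = op_code opr" "v3 12 = op_arg opr"
      by (simp_all add: v3 v2_def)
    have pos: "0 \<le> node s (z < 0)" "0 \<le> node s' (z \<noteq> 0)" by (simp_all add: node_def)
    show ?thesis unfolding c_def loop_free_wp.simps(3)[of B emit]
      by (rule loop_free_wp_mono[OF emit_correct[OF r3 e3 pos]])
        (auto simp: es1_def[symmetric] v3 v2_def intro!: second)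
  qed
  show ?thesis
    unfolding read_transition_def inp t c2_def[symmetric] c_def[symmetric] Q_def[symmetric, unfolded t]
    by (auto simp: encode_transition_def encode_op_eq v node_def intro!: first[unfolded t] simp: v2_def)
qed

definition skip_list :: com where
  "skip_list = Basic (Read rLoop) ;; WhilePos rLoop (Basic (Read 21) ;; Basic (Sub rLoop rLoop rOne))"

definition read_header :: com where
  "read_header =
    Basic (Read 21) ;; Basic (Read 22) ;; Basic (Read 23) ;;
    Basic (Add rStart 22 22) ;; Basic (Add rStart rStart rOne) ;;
    Basic (Add rGoal 23 23) ;; Basic (Add rGoal rGoal rOne) ;; Basic (Add rGoal rGoal rOne) ;;
    Basic (Const rPtr 32) ;; Basic (Const rDim 64) ;; Basic (Const rCount 0) ;;
    Basic (Add 8 rGoal rZero) ;; Basic (Const 9 0) ;; Basic (Const 10 0) ;; Basic (Const 11 0) ;; Basic (Const 12 0) ;;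
    emit ;; Basic (Read rLoop)"

definition read_input :: com where
  "read_input = Basic (Const rOne 1) ;; skip_list ;; skip_list ;; read_header ;; WhilePos rLoop read_transition"

lemma wp_Seq_post: "wp B c1 N1 R \<sigma> \<Longrightarrow> (\<And>\<sigma>'. R \<sigma>' \<Longrightarrow> wp B c2 N2 Q \<sigma>') \<Longrightarrow> wp B (c1 ;; c2) (N1 + N2) Q \<sigma>"
  by (rule wp_Seq) (auto intro: wp_mono)

lemma wp_skip_list:
  assumes "v rOne = 1"
  shows "wp B skip_list (4 * length xs + 3)
    (\<lambda>\<sigma>. \<exists>v'. \<sigma> = (v', m, rest, out) \<and> v' rOne = 1 \<and> v' rZero = v rZero)
    (v, m, int (length xs) # xs @ rest, out)"
proof -
  let ?I = "\<lambda>i \<sigma>. \<exists>v'. \<sigma> = (v', m, drop i xs @ rest, out) \<and> v' rOne = 1 \<and> v' rZero = v rZero \<and>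
    v' rLoop = int (length xs) - int i"
  have "wp B (Basic (Read rLoop)) 1 (?I 0) (v, m, int (length xs) # xs @ rest, out)"
    using wp_loop_free[of B "Basic (Read rLoop)" "?I 0"] assms by simp
  moreover have "wp B (WhilePos rLoop (Basic (Read 21) ;; Basic (Sub rLoop rLoop rOne)))
    (length xs * (2 + 2) + 2) (?I (length xs)) \<sigma>" if "?I 0 \<sigma>" for \<sigma>
  proof (rule wp_WhilePos[where I = ?I, OF _ _ _ that])
    fix i \<sigma> assume i: "i < length xs" "?I i \<sigma>"
    then obtain v' where v': "\<sigma> = (v', m, drop i xs @ rest, out)" "v' rOne = 1" "v' rZero = v rZero"
      "v' rLoop = int (length xs) - int i" by blast
    have "loop_free_wp B (Basic (Read 21) ;; Basic (Sub rLoop rLoop rOne)) (?I (Suc i)) \<sigma>"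
      using v' i(1) by (simp add: Cons_nth_drop_Suc[symmetric])
    from wp_loop_free[OF this]
    show "wp B (Basic (Read 21) ;; Basic (Sub rLoop rLoop rOne)) 2 (?I (Suc i)) \<sigma>" by (simp add: numeral_2_eq_2)
  qed auto
  ultimately have "wp B skip_list (1 + (length xs * (2 + 2) + 2)) (?I (length xs))
    (v, m, int (length xs) # xs @ rest, out)"
    unfolding skip_list_def by (rule wp_Seq_post)
  then show ?thesis by (rule wp_mono) auto
qed

lemma read_header_correct:
  assumes v: "v rZero = 0" "v rOne = 1" and "0 \<le> g"
  shows "loop_free_wp B read_header (\<lambda>(v', m', inp', out'). reading [(2 * g + 2, 0, 0, NoOp)] v' m' \<and>
    v' rStart = 2 * s + 1 \<and> v' rLoop = k \<and> inp' = rest \<and> out' = out) (v, \<lambda>_. 0, b # s # g # k # rest, out)"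
proof -
  define Q where "Q = (\<lambda>(v', m', inp', out'). reading [(2 * g + 2, 0, 0, NoOp)] v' m' \<and>
    v' rStart = 2 * s + 1 \<and> v' rLoop = k \<and> inp' = rest \<and> out' = out)"
  have Q: "Q (v', m', rest, out) \<longleftrightarrow> reading [(2 * g + 2, 0, 0, NoOp)] v' m' \<and>
    v' rStart = 2 * s + 1 \<and> v' rLoop = k" for v' m'
    by (simp add: Q_def)
  define c where "c = emit ;; Basic (Read rLoop)"
  have c: "loop_free_wp B c Q (v1, \<lambda>_. 0, k # rest, out)"
    if r: "reading [] v1 (\<lambda>_. 0)" "v1 8 = 2 * g + 2" "v1 9 = 0" "v1 10 = 0" "v1 11 = op_code NoOp"
      "v1 12 = op_arg NoOp" "v1 rStart = 2 * s + 1" for v1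
    unfolding c_def loop_free_wp.simps(3)[of B emit]
    by (rule loop_free_wp_mono[OF emit_correct[OF r(1-6)]])
      (use r(7) \<open>0 \<le> g\<close> in \<open>auto simp: Q reading_def\<close>)
  show ?thesis
    unfolding read_header_def c_def[symmetric] Q_def[symmetric]
    using v by (auto simp: reading_def stored_def dim_ok_def intro!: c)
qed

lemma encode_pvass_eq:
  "encode_pvass A = (let ss = sorted_list_of_set (states A);
       gs = sorted_list_of_set (stack_alphabet A);
       ts = transition_list A
     in int (length (map int ss)) # map int ss @ int (length (map int gs)) # map int gs @
       int (bottom A) # int (init_state A) # int (acc_state A) # int (length ts) # concat (map encode_transition ts))"
proof -
  have "encode_transition = (\<lambda>(s, s', z, opr). [int s, int s', z] @ encode_op opr)"
    by (simp add: encode_transition_def)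
  then show ?thesis unfolding encode_pvass_def Let_def by simp
qed

lemma length_encode_pvass:
  "length (encode_pvass A) =
    length (sorted_list_of_set (states A)) + length (sorted_list_of_set (stack_alphabet A)) +
    5 * length (transition_list A) + 6"
proof -
  have "length (encode_transition t) = 5" for t
    by (auto simp: encode_transition_def encode_op_eq split: prod.splits)
  then have "length (concat (map encode_transition ts)) = 5 * length ts" for ts
    by (induction ts) auto
  then show ?thesis by (simp add: encode_pvass_eq Let_def)
qed

lemma wp_read_input:
  "wp B read_input ((code_length read_input + 2) * length (encode_pvass A))
    (\<lambda>(v, m, inp, out). reading (all_edges A) v m \<and> v rStart = start_node A \<and> out = [])
    (\<lambda>_. 0, \<lambda>_. 0, encode_pvass A, [])"
proof -
  define ss where "ss = map int (sorted_list_of_set (states A))"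
  define gs where "gs = map int (sorted_list_of_set (stack_alphabet A))"
  define ts where "ts = transition_list A"
  define g where "g = int (acc_state A)"
  define i2 where "i2 = int (bottom A) # int (init_state A) # g # int (length ts) # concat (map encode_transition ts)"
  define i1 where "i1 = int (length gs) # gs @ i2"
  have enc: "encode_pvass A = int (length ss) # ss @ i1"
    by (simp add: encode_pvass_eq Let_def i1_def i2_def ss_def gs_def ts_def g_def)
  let ?R0 = "\<lambda>inp \<sigma>. \<exists>v'. \<sigma> = (v' :: nat \<Rightarrow> int, \<lambda>_. 0 :: int, inp, []) \<and> v' rOne = 1 \<and> v' rZero = 0"
  let ?I = "\<lambda>i (v', m', inp', out'). 
    reading ((2 * g + 2, 0, 0, NoOp) # concat (map edges_of (take i ts))) v' m' \<and>
    v' rStart = start_node A \<and> v' rLoop = int (length ts) - int i \<and>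
    inp' = concat (map encode_transition (drop i ts)) \<and> out' = ([] :: int list)"
  have 1: "wp B (Basic (Const rOne 1)) 1 (?R0 (encode_pvass A)) (\<lambda>_. 0, \<lambda>_. 0, encode_pvass A, [])"
    using wp_loop_free[of B "Basic (Const rOne 1)" "?R0 (encode_pvass A)"] by simp
  have skip: "wp B skip_list (4 * length xs + 3) (?R0 rest) \<sigma>" if R: "?R0 (int (length xs) # xs @ rest) \<sigma>"
    for xs rest \<sigma>
  proof -
    obtain v' where v': "\<sigma> = (v', \<lambda>_. 0, int (length xs) # xs @ rest, [])" "v' rOne = 1" "v' rZero = 0"
      using R by blast
    show ?thesis unfolding v'(1) by (rule wp_mono[OF wp_skip_list[of v', OF v'(2)]]) (use v'(3) in auto)
  qed
  have 2: "wp B skip_list (4 * length ss + 3) (?R0 i1) \<sigma>" if "?R0 (encode_pvass A) \<sigma>" for \<sigma>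
    using that unfolding enc by (rule skip)
  have 3: "wp B skip_list (4 * length gs + 3) (?R0 i2) \<sigma>" if "?R0 i1 \<sigma>" for \<sigma>
    using that unfolding i1_def by (rule skip)
  have 4: "wp B read_header (code_length read_header) (?I 0) \<sigma>" if R: "?R0 i2 \<sigma>" for \<sigma>
  proof (rule wp_loop_free)
    obtain v' where v': "\<sigma> = (v', \<lambda>_. 0, i2, [])" "v' rZero = 0" "v' rOne = 1" using R by auto
    show "loop_free_wp B read_header (?I 0) \<sigma>"
      unfolding v'(1) i2_def
      by (rule loop_free_wp_mono[OF read_header_correct[OF v'(2,3)]]) (auto simp: g_def node_def)
  qed
  have 5: "wp B (WhilePos rLoop read_transition) (length ts * (code_length read_transition + 2) + 2)
    (?I (length ts)) \<sigma>" if "?I 0 \<sigma>" for \<sigma>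
  proof (rule wp_WhilePos[where I = ?I, OF _ _ _ that])
    fix i \<sigma> assume i: "i < length ts" "?I i \<sigma>"
    obtain v m inp out where \<sigma>: "\<sigma> = (v, m, inp, out)" by (metis prod_cases4)
    have r: "reading ((2 * g + 2, 0, 0, NoOp) # concat (map edges_of (take i ts))) v m"
      and inp: "inp = encode_transition (ts ! i) @ concat (map encode_transition (drop (Suc i) ts))"
      using i by (auto simp: \<sigma> Cons_nth_drop_Suc[symmetric])
    have es: "(2 * g + 2, 0, 0, NoOp) # concat (map edges_of (take (Suc i) ts)) =
      ((2 * g + 2, 0, 0, NoOp) # concat (map edges_of (take i ts))) @ edges_of (ts ! i)"
      using i(1) by (simp add: take_Suc_conv_app_nth)
    show "wp B read_transition (code_length read_transition) (?I (Suc i)) \<sigma>"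
      unfolding \<sigma>
      by (rule wp_loop_free, rule loop_free_wp_mono[OF read_transition_correct[OF r inp]])
        (use i in \<open>auto simp: es \<sigma> simp del: edges_of.simps\<close>)
  qed auto
  have all: "all_edges A = (2 * g + 2, 0, 0, NoOp) # concat (map edges_of (take (length ts) ts))"
    by (simp add: all_edges_def ts_def g_def node_def)
  have "wp B read_input (1 + (4 * length ss + 3 + (4 * length gs + 3 + (code_length read_header +
      (length ts * (code_length read_transition + 2) + 2))))) (?I (length ts)) (\<lambda>_. 0, \<lambda>_. 0, encode_pvass A, [])"
    unfolding read_input_def
    by (rule wp_Seq_post[OF 1 wp_Seq_post[OF 2 wp_Seq_post[OF 3 wp_Seq_post[OF 4 5]]]])
  then show ?thesis
  proof (rule wp_mono)
    have len: "length (encode_pvass A) = length ss + length gs + 5 * length ts + 6"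
      by (simp add: length_encode_pvass ss_def gs_def ts_def)
    \<comment> \<open>Each input integer is charged the whole header and one pass through the
      transition code; 10 absorbs the remaining constants.\<close>
    let ?c = "code_length read_header + code_length read_transition + 10"
    have "code_length read_input + 2 \<ge> ?c"
      by (simp add: read_input_def skip_list_def)
    then have "(code_length read_input + 2) * length (encode_pvass A) \<ge> ?c * length (encode_pvass A)"
      by (rule mult_le_mono1)
    then show "1 + (4 * length ss + 3 + (4 * length gs + 3 + (code_length read_header +
      (length ts * (code_length read_transition + 2) + 2)))) \<le> (code_length read_input + 2) * length (encode_pvass A)"
      unfolding len by (rule order_trans[rotated]) (simp add: algebra_simps)
  qed (auto simp: all)
qed

section \<open>One round as three nested loops over the table\<close>

definition for_pairs :: "nat \<Rightarrow> nat \<Rightarrow> com \<Rightarrow> com" where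
  "for_pairs i c body = Basic (Const i 32) ;; Basic (Add c rCount rZero) ;;
     WhilePos c (body ;; Basic (Const 31 8) ;; Basic (Add i i 31) ;; Basic (Sub c c rOne))"

lemma wp_for_pairs:
  fixes J :: "nat \<Rightarrow> store \<Rightarrow> bool"
  assumes step: "\<And>k v m inp out. k < n \<Longrightarrow> J k (v, m, inp, out) \<Longrightarrow> v i = 32 + 8 * int k \<Longrightarrow>
      wp B body N (\<lambda>(v', m', inp', out'). J (Suc k) (v', m', inp', out') \<and> v' i = v i \<and> v' c = v c \<and> v' rOne = 1)
        (v, m, inp, out)"
    and stable: "\<And>k v m inp out r x. r \<in> {i, c, 31} \<Longrightarrow> J k (v, m, inp, out) \<Longrightarrow> J k (v(r := x), m, inp, out)"
    and J: "J 0 (v, m, inp, out)"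
    and regs: "i < 31" "c < 31" "i \<noteq> c" "i \<notin> {0, 1, 3}" "c \<notin> {0, 1, 3}" "v rZero = 0" "v rCount = int n"
  shows "wp B (for_pairs i c body) (n * (N + 5) + 4) (J n) (v, m, inp, out)"
proof -
  let ?I = "\<lambda>k (v, m, inp, out). J k (v, m, inp, out) \<and> v i = 32 + 8 * int k \<and> v c = int n - int k"
  have 1: "wp B (Basic (Const i 32)) 1 (\<lambda>\<sigma>. \<sigma> = (v(i := 32), m, inp, out)) (v, m, inp, out)"
    using wp_loop_free[of B "Basic (Const i 32)" "\<lambda>\<sigma>. \<sigma> = (v(i := 32), m, inp, out)"] regs by simp
  have 2: "wp B (Basic (Add c rCount rZero)) 1 (?I 0) \<sigma>" if "\<sigma> = (v(i := 32), m, inp, out)" for \<sigma>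
    using wp_loop_free[of B "Basic (Add c rCount rZero)" "?I 0"] regs that
    by (simp add: stable J)
  have 3: "wp B (WhilePos c (body ;; Basic (Const 31 8) ;; Basic (Add i i 31) ;; Basic (Sub c c rOne)))
    (n * ((N + 3) + 2) + 2) (?I n) \<sigma>" if "?I 0 \<sigma>" for \<sigma>
  proof (rule wp_WhilePos[where I = ?I, OF _ _ _ that])
    fix k \<sigma> assume k: "k < n" "?I k \<sigma>"
    obtain v m inp out where \<sigma>: "\<sigma> = (v, m, inp, out)" by (metis prod_cases4)
    have "wp B body N (\<lambda>(v', m', inp', out'). J (Suc k) (v', m', inp', out') \<and> v' i = v i \<and> v' c = v c \<and> v' rOne = 1) \<sigma>"
      using step[of k v m inp out] k \<sigma> by simp
    moreover have "wp B (Basic (Const 31 8) ;; Basic (Add i i 31) ;; Basic (Sub c c rOne)) 3 (?I (Suc k)) \<sigma>'"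
      if "(\<lambda>(v', m', inp', out'). J (Suc k) (v', m', inp', out') \<and> v' i = v i \<and> v' c = v c \<and> v' rOne = 1) \<sigma>'" for \<sigma>'
    proof -
      obtain v' m' inp' out' where \<sigma>': "\<sigma>' = (v', m', inp', out')" by (metis prod_cases4)
      have "loop_free_wp B (Basic (Const 31 8) ;; Basic (Add i i 31) ;; Basic (Sub c c rOne)) (?I (Suc k)) \<sigma>'"
        using that k \<sigma> \<sigma>' regs by (simp add: stable)
      from wp_loop_free[OF this] show ?thesis by (simp add: numeral_3_eq_3)
    qed
    ultimately show "wp B (body ;; Basic (Const 31 8) ;; Basic (Add i i 31) ;; Basic (Sub c c rOne)) (N + 3) (?I (Suc k)) \<sigma>"
      by (rule wp_Seq_post)
  qed (use regs in auto)
  have "wp B (for_pairs i c body) (1 + (1 + (n * ((N + 3) + 2) + 2))) (?I n) (v, m, inp, out)"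
    unfolding for_pairs_def by (rule wp_Seq_post[OF 1 wp_Seq_post[OF 2 3]])
  then show ?thesis by (rule wp_mono) (auto simp: algebra_simps)
qed

abbreviation (input) load_field :: "nat \<Rightarrow> int \<Rightarrow> nat \<Rightarrow> com" where
  "load_field r k i \<equiv> Basic (Const r k) ;; Basic (Add r r i) ;; Basic (Load r r)"

text \<open>
  Registers 8, 10 and 12 point to the pairs for the row, the push and the pop.
\<close>
definition relax_code :: com where
  "relax_code =
    load_field 22 0 10 ;; Basic (Add 22 15 22) ;; Basic (Load 22 22) ;;
    load_field 23 1 10 ;; Basic (Add 23 23 rOne) ;; Basic (Mult 23 23 rDim) ;;
    load_field 24 4 12 ;; Basic (Add 23 23 24) ;; Basic (Load 23 23) ;;
    IfPos 22 (IfPos 23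
      (Basic (Add 22 22 23) ;; load_field 24 2 10 ;; Basic (Add 22 22 24) ;;
       load_field 24 6 12 ;; Basic (Add 22 22 24) ;; Basic (Sub 22 22 rOne) ;;
       load_field 24 5 12 ;; Basic (Add 24 15 24) ;; Basic (Load 25 24) ;; Basic (Sub 25 22 25) ;;
       IfPos 25 (Basic (Store 24 22)) Skip) Skip) Skip"

text \<open>Branching is possible on positivity only, so equality of symbols is tested by two
  differences neither of which may be positive. Register 15 keeps the row offset of
  \<open>r0\<close> for \<open>relax_code\<close>.\<close>

definition step_code :: com where
  "step_code =
    Basic (Load 14 8) ;; Basic (Add 15 14 rOne) ;; Basic (Mult 15 15 rDim) ;;
    Basic (Add 16 15 14) ;; Basic (Load 17 16) ;; IfPos 17 Skip (Basic (Store 16 rOne)) ;;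
    load_field 18 3 10 ;; load_field 19 7 12 ;;
    Basic (Sub 20 18 19) ;; Basic (Sub 21 19 18) ;;
    IfPos 20 Skip (IfPos 21 Skip relax_code)"

text \<open>
  The dimension \<open>D\<close> exceeds all nodes and all addresses of stored pairs, so that
  cells are disjoint from each other and from the pairs.
\<close>
definition cells_at :: "(int \<Rightarrow> int) \<Rightarrow> int \<Rightarrow> (int \<times> int \<Rightarrow> int) \<Rightarrow> bool" where
  "cells_at m D V \<longleftrightarrow> (\<forall>p q. 0 \<le> p \<longrightarrow> 0 \<le> q \<longrightarrow> q < D \<longrightarrow> m ((p + 1) * D + q) = V (p, q))"

lemma cells_atD: "cells_at m D V \<Longrightarrow> 0 \<le> p \<Longrightarrow> 0 \<le> q \<Longrightarrow> q < D \<Longrightarrow> m ((p + 1) * D + q) = V (p, q)"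
  by (simp add: cells_at_def)

text \<open>The limit on \<open>rDim\<close>, together with the node bounds in
  \<open>dim_ok\<close>, keeps both factors of every address computation within the guard of
  \<open>Mult\<close>.\<close>

definition computing :: "nat \<Rightarrow> edge list \<Rightarrow> (int \<times> int \<Rightarrow> int) \<Rightarrow> (nat \<Rightarrow> int) \<Rightarrow> (int \<Rightarrow> int) \<Rightarrow> bool" where
  "computing B es V v m \<longleftrightarrow> v rZero = 0 \<and> v rOne = 1 \<and> v rCount = int (length es) \<and>
     dim_ok (v rDim) es \<and> v rDim \<le> 2 ^ B \<and> stored m es \<and> cells_at m (v rDim) V"

lemma cell_address_inj:
  fixes D :: int
  assumes "(p + 1) * D + q = (p' + 1) * D + q'" "0 \<le> q" "q < D" "0 \<le> q'" "q' < D"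
  shows "p = p'" "q = q'"
proof -
  have "((p + 1) * D + q) div D = p + 1" "((p' + 1) * D + q') div D = p' + 1"
    using assms(2-5) by (simp_all add: div_add1_eq div_pos_pos_trivial)
  then show "p = p'" using assms(1) by simp
  then show "q = q'" using assms(1) by simp
qed

text \<open>Shifting rows by one makes even row 0 start at \<open>D\<close>, beyond the program
  variables and the table.\<close>

lemma cell_address_ge:
  fixes D :: int
  assumes "0 \<le> p" "0 \<le> q" "0 \<le> D"
  shows "D \<le> (p + 1) * D + q"
  using assms by (simp add: distrib_right)

lemma cells_at_upd:
  assumes "cells_at m D V" "0 \<le> q" "q < D"
  shows "cells_at (m((p + 1) * D + q := x)) D (V((p, q) := x))"
  using assms cell_address_inj[of _ D _ p q] unfolding cells_at_def by (auto simp del: add_right_cancel)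

lemma stored_upd:
  assumes "stored m es" "32 + 8 * int (length es) \<le> a"
  shows "stored (m(a := x)) es"
proof -
  have "8 * int i + 8 \<le> 8 * int (length es)" if "i < length es" for i using that by linarith
  then show ?thesis using assms unfolding stored_def pair_at_def by fastforce
qed

lemma rule_pair_bounds:
  assumes "dim_ok D es" "r \<in> set (rule_pairs es)"
  shows "0 \<le> src1 r \<and> src1 r < D \<and> 0 \<le> dst1 r \<and> dst1 r < D \<and> 0 \<le> src2 r \<and> src2 r < D \<and> 0 \<le> dst2 r \<and> dst2 r < D"
proof -
  obtain i where i: "i < length es" "r = rule_pair_of (- (32 + 8 * int i)) (es ! i)"
    using assms(2) mem_rule_pairs by blast
  obtain p q w opr where e: "es ! i = (p, q, w, opr)" by (metis prod_cases4)
  then have "(p, q, w, opr) \<in> set es" using i(1) nth_mem by metis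
  then have "0 \<le> p \<and> p < D \<and> 0 \<le> q \<and> q < D" "0 < D" using assms(1) unfolding dim_ok_def by auto
  then show ?thesis using i(2) e by (cases opr) auto
qed

lemma computing_upd:
  assumes "computing B es V v m" "0 \<le> p" "0 \<le> q" "q < v rDim"
  shows "computing B es (V((p, q) := x)) v (m((p + 1) * v rDim + q := x))"
proof -
  have "v rDim \<le> (p + 1) * v rDim + q" using cell_address_ge[of p q "v rDim"] assms by simp
  moreover have "32 + 8 * int (length es) < v rDim" using assms(1) by (simp add: computing_def dim_ok_def)
  ultimately show ?thesis
    using assms unfolding computing_def by (auto intro!: cells_at_upd stored_upd)
qed

lemma step_code_correct:
  assumes comp: "computing B es V v m"
    and ijk: "i < length es" "j < length es" "k < length es"
    and ptrs: "v 8 = 32 + 8 * int i" "v 10 = 32 + 8 * int j" "v 12 = 32 + 8 * int k"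
  shows "loop_free_wp B step_code (\<lambda>(v', m', inp', out').
    computing B es (step_cells (rule_pairs es ! i) (rule_pairs es ! j) (rule_pairs es ! k) V) v' m' \<and>
    (\<forall>r \<in> {5, 7, 8, 9, 10, 11, 12, 13}. v' r = v r) \<and> inp' = inp \<and> out' = out) (v, m, inp, out)"
proof -
  define r0 where "r0 = rule_pairs es ! i"
  define r1 where "r1 = rule_pairs es ! j"
  define r2 where "r2 = rule_pairs es ! k"
  define D where "D = v rDim"
  have regs: "v 0 = 0" "v (Suc 0) = 1" "v 2 = D" using comp by (auto simp: computing_def D_def)
  have D: "32 \<le> D" "D \<le> 2 ^ B" "32 + 8 * int (length es) < D" "dim_ok D es"
    using comp by (auto simp: computing_def dim_ok_def D_def)
  have bounds: "0 \<le> src1 r0" "src1 r0 < D" "0 \<le> src1 r1" "src1 r1 < D" "0 \<le> dst1 r1" "dst1 r1 < D"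
    "0 \<le> src2 r2" "src2 r2 < D" "0 \<le> dst2 r2" "dst2 r2 < D"
    using rule_pair_bounds[OF D(4), of r0] rule_pair_bounds[OF D(4), of r1] rule_pair_bounds[OF D(4), of r2]
      ijk by (auto simp: r0_def r1_def r2_def)
  have pairs: "pair_at m' (32 + 8 * int i) r0" "pair_at m' (32 + 8 * int j) r1" "pair_at m' (32 + 8 * int k) r2"
    if "computing B es V' v m'" for V' m'
    using that ijk by (auto simp: computing_def stored_def r0_def r1_def r2_def)
  have frame: "computing B es V' v m' \<Longrightarrow> (\<And>r. r < 14 \<Longrightarrow> v' r = v r) \<Longrightarrow> computing B es V' v' m'" for V' v' m'
    by (simp add: computing_def)
  have cell: "m' ((p + 1) * D + q) = V' (p, q)" if "computing B es V' v m'" "0 \<le> p" "0 \<le> q" "q < D" for V' m' p q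
    using that by (auto simp: computing_def cells_at_def D_def)
  have upd: "computing B es (V'((p, q) := x)) v (m'((p + 1) * D + q := x))"
    if "computing B es V' v m'" "0 \<le> p" "0 \<le> q" "q < D" for V' m' p q x
    using computing_upd that by (auto simp: D_def)
  have ge: "32 \<le> (p + 1) * D + q" if "0 \<le> p" "0 \<le> q" for p q
    using cell_address_ge[of p q D] that D(1) by simp
  have abs: "\<bar>p + 1\<bar> \<le> 2 ^ B" if "0 \<le> p" "p < D" for p using that D(2) by simp
  define Q where "Q = (\<lambda>(v', m', inp', out'). computing B es (step_cells r0 r1 r2 V) v' m' \<and>
    (\<forall>r \<in> {5, 7, 8, 9, 10, 11, 12, 13}. v' r = v r) \<and> inp' = inp \<and> out' = out)"
  have Q: "Q (v', m', inp, out)" if "computing B es (step_cells r0 r1 r2 V) v m'" "\<And>r. r < 14 \<Longrightarrow> v' r = v r" for v' m'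
    using that frame unfolding Q_def by simp
  \<comment> \<open>Execution is cut after the axiom cell has been set, and again before the
    relaxation, so that each stage reads from one known memory.\<close>
  define V1 where "V1 = init_cell (src1 r0, src1 r0) V"
  have relax: "loop_free_wp B relax_code Q (v1, m1, inp, out)"
    if c1: "computing B es V1 v m1" and v1: "\<And>r. r < 14 \<Longrightarrow> v1 r = v r" "v1 15 = (src1 r0 + 1) * D"
      and sym: "sym1 r1 = sym2 r2" for v1 m1
  proof -
    note p = pairs[OF c1, unfolded pair_at_def]
    have s: "step_cells r0 r1 r2 V =
      (let x = V1 (src1 r0, src1 r1) + V1 (dst1 r1, src2 r2) + wt1 r1 + wt2 r2 - 1 in
       if 0 < V1 (src1 r0, src1 r1) \<and> 0 < V1 (dst1 r1, src2 r2) \<and> V1 (src1 r0, dst2 r2) < x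
       then V1((src1 r0, dst2 r2) := x) else V1)"
      using sym by (simp add: step_cells_def V1_def Let_def relax_def add.assoc)
    show ?thesis
      unfolding relax_code_def
      using bounds abs[of "dst1 r1"] D(2) p
      by (auto simp: v1 regs ptrs cell[OF c1] ge s Let_def intro!: Q c1 upd)
  qed
  have "loop_free_wp B step_code Q (v, m, inp, out)"
  proof -
    note p = pairs[OF comp, unfolded pair_at_def]
    have s: "step_cells r0 r1 r2 V = V1" if "sym1 r1 \<noteq> sym2 r2"
      using that by (simp add: step_cells_def V1_def)
    define c where "c = load_field 18 3 10 ;; load_field 19 7 12 ;;
      Basic (Sub 20 18 19) ;; Basic (Sub 21 19 18) ;; IfPos 20 Skip (IfPos 21 Skip relax_code)"
    have rest: "loop_free_wp B c Q (v1, m1, inp, out)"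
      if c1: "computing B es V1 v m1" and v1: "\<And>r. r < 14 \<Longrightarrow> v1 r = v r" "v1 15 = (src1 r0 + 1) * D"
      for v1 m1
      unfolding c_def using pairs[OF c1, unfolded pair_at_def] by (auto simp: v1 regs ptrs s intro!: Q c1 relax)
    have V1: "computing B es V1 v (if 0 < V (src1 r0, src1 r0) then m
      else m((src1 r0 + 1) * D + src1 r0 := 1))"
      using upd[OF comp, of "src1 r0" "src1 r0" 1] comp bounds by (simp add: V1_def init_cell_def)
    show ?thesis
      unfolding step_code_def c_def[symmetric]
      using bounds abs[of "src1 r0"] D(2) p V1
      by (auto simp: regs ptrs cell[OF comp] ge intro!: rest)
  qed
  then show ?thesis by (simp add: Q_def r0_def r1_def r2_def)
qed

text \<open>A loop over the table acts as a \<open>fold\<close> over \<open>rule_pairs\<close>.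
  \<open>S\<close> holds the registers that must survive the loop; for the inner loops these include
  the pointers and counters of the enclosing ones.\<close>

lemma wp_for_pairs_fold:
  assumes body: "\<And>k V v m. computing B es V v m \<Longrightarrow> (\<And>r. r \<in> S \<Longrightarrow> v r = v0 r) \<Longrightarrow> k < length es \<Longrightarrow>
      v i = 32 + 8 * int k \<Longrightarrow>
      wp B body N (\<lambda>(v', m', inp', out'). computing B es (f (rule_pairs es ! k) V) v' m' \<and>
        (\<forall>r \<in> insert i (insert c S). v' r = v r) \<and> inp' = inp \<and> out' = out) (v, m, inp, out)"
    and comp: "computing B es V v0 m"
    and regs: "i < 31" "c < 31" "i \<noteq> c" "3 < i" "3 < c" "S \<inter> {i, c, 31} = {}"
  shows "wp B (for_pairs i c body) (length es * (N + 5) + 4)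
    (\<lambda>(v', m', inp', out'). computing B es (fold f (rule_pairs es) V) v' m' \<and>
      (\<forall>r \<in> S. v' r = v0 r) \<and> inp' = inp \<and> out' = out) (v0, m, inp, out)"
proof -
  let ?J = "\<lambda>k (v', m', inp', out'). computing B es (fold f (take k (rule_pairs es)) V) v' m' \<and>
    (\<forall>r \<in> S. v' r = v0 r) \<and> inp' = inp \<and> out' = out"
  have "wp B (for_pairs i c body) (length es * (N + 5) + 4) (?J (length es)) (v0, m, inp, out)"
  proof (rule wp_for_pairs)
    fix k v m inp' out' assume k: "k < length es" "?J k (v, m, inp', out')" "v i = 32 + 8 * int k"
    let ?V = "fold f (take k (rule_pairs es)) V"
    have "wp B body N (\<lambda>(v', m', inp', out'). computing B es (f (rule_pairs es ! k) ?V) v' m' \<and>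
        (\<forall>r \<in> insert i (insert c S). v' r = v r) \<and> inp' = inp \<and> out' = out) (v, m, inp, out)"
      using k by (intro body) auto
    then show "wp B body N (\<lambda>(v', m', inp', out'). ?J (Suc k) (v', m', inp', out') \<and> v' i = v i \<and> v' c = v c \<and> v' rOne = 1)
      (v, m, inp', out')"
      using k by (auto elim!: wp_mono simp: take_Suc_conv_app_nth computing_def)
  next
    show "?J k (v(r := x), m, inp', out')" if "r \<in> {i, c, 31}" "?J k (v, m, inp', out')" for k v m inp' out' r x
      using that regs by (auto simp: computing_def)
  qed (use comp regs in \<open>auto simp: computing_def\<close>)
  then show ?thesis by simp
qed

definition round_code :: com where
  "round_code = for_pairs 8 9 (for_pairs 10 11 (for_pairs 12 13 step_code))"

definition round_steps :: "nat \<Rightarrow> nat" where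
  "round_steps n = n * ((n * ((n * (code_length step_code + 5) + 4) + 5) + 4) + 5) + 4"

lemma wp_round_code:
  assumes comp: "computing B es V v m"
  shows "wp B round_code (round_steps (length es))
    (\<lambda>(v', m', inp', out'). computing B es (round_cells (rule_pairs es) V) v' m' \<and>
      (\<forall>r \<in> {5, 7}. v' r = v r) \<and> inp' = inp \<and> out' = out) (v, m, inp, out)"
  unfolding round_code_def round_steps_def round_cells_def
proof (rule wp_for_pairs_fold[OF _ comp])
  fix k0 V v1 m assume 1: "computing B es V v1 m" "k0 < length es" "v1 8 = 32 + 8 * int k0"
  have "wp B (for_pairs 10 11 (for_pairs 12 13 step_code))
     (length es * ((length es * (code_length step_code + 5) + 4) + 5) + 4)
     (\<lambda>(v', m', inp', out'). computing B es
        (fold (\<lambda>r1. fold (step_cells (rule_pairs es ! k0) r1) (rule_pairs es)) (rule_pairs es) V) v' m' \<and>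
        (\<forall>r \<in> {5, 7, 8, 9}. v' r = v1 r) \<and> inp' = inp \<and> out' = out) (v1, m, inp, out)"
  proof (rule wp_for_pairs_fold[OF _ 1(1)])
    fix k1 V v2 m assume 2: "computing B es V v2 m" "\<And>r. r \<in> {5, 7, 8, 9} \<Longrightarrow> v2 r = v1 r" "k1 < length es"
      "v2 10 = 32 + 8 * int k1"
    have "wp B (for_pairs 12 13 step_code) (length es * (code_length step_code + 5) + 4)
     (\<lambda>(v', m', inp', out'). computing B es
        (fold (step_cells (rule_pairs es ! k0) (rule_pairs es ! k1)) (rule_pairs es) V) v' m' \<and>
        (\<forall>r \<in> {5, 7, 8, 9, 10, 11}. v' r = v2 r) \<and> inp' = inp \<and> out' = out) (v2, m, inp, out)"
    proof (rule wp_for_pairs_fold[OF _ 2(1)])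
      fix k2 V v3 m assume 3: "computing B es V v3 m" "\<And>r. r \<in> {5, 7, 8, 9, 10, 11} \<Longrightarrow> v3 r = v2 r"
        "k2 < length es" "v3 12 = 32 + 8 * int k2"
      have "v3 8 = 32 + 8 * int k0" "v3 10 = 32 + 8 * int k1" using 1 2 3 by simp_all
      from wp_loop_free[OF step_code_correct[OF 3(1) 1(2) 2(3) 3(3) this 3(4)]]
      show "wp B step_code (code_length step_code) (\<lambda>(v', m', inp', out'). computing B es
          (step_cells (rule_pairs es ! k0) (rule_pairs es ! k1) (rule_pairs es ! k2) V) v' m' \<and>
          (\<forall>r \<in> insert 12 (insert 13 {5, 7, 8, 9, 10, 11}). v' r = v3 r) \<and> inp' = inp \<and> out' = out)
        (v3, m, inp, out)" by (rule wp_mono) auto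
    qed auto
    then show "wp B (for_pairs 12 13 step_code) (length es * (code_length step_code + 5) + 4)
     (\<lambda>(v', m', inp', out'). computing B es
        (fold (step_cells (rule_pairs es ! k0) (rule_pairs es ! k1)) (rule_pairs es) V) v' m' \<and>
        (\<forall>r \<in> insert 10 (insert 11 {5, 7, 8, 9}). v' r = v2 r) \<and> inp' = inp \<and> out' = out) (v2, m, inp, out)"
      by (rule wp_mono) auto
  qed auto
  then show "wp B (for_pairs 10 11 (for_pairs 12 13 step_code))
     (length es * ((length es * (code_length step_code + 5) + 4) + 5) + 4)
     (\<lambda>(v', m', inp', out'). computing B es
        (fold (\<lambda>r1. fold (step_cells (rule_pairs es ! k0) r1) (rule_pairs es)) (rule_pairs es) V) v' m' \<and>
        (\<forall>r \<in> insert 8 (insert 9 {5, 7}). v' r = v1 r) \<and> inp' = inp \<and> out' = out) (v1, m, inp, out)"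
    by (rule wp_mono) auto
qed auto

text \<open>Column 0 is the sink, so the address of the final cell is the row offset of the start
  node alone. A positive entry is decoded by subtracting one; an entry 0, meaning that no path
  reaches the goal, is itself the bound.\<close>

definition main_code :: com where
  "main_code =
    (Basic (Add 14 rCount rOne) ;; Basic (Mult rLoop 14 14)) ;;
    WhilePos rLoop (round_code ;; Basic (Sub rLoop rLoop rOne)) ;;
    Basic (Add 14 rStart rOne) ;; Basic (Mult 14 14 rDim) ;; Basic (Load 14 14) ;;
    IfPos 14 (Basic (Sub 14 14 rOne)) Skip ;; Basic (Write 14)"

lemma wp_main_code:
  assumes comp: "computing B es (\<lambda>_. 0) v m"
    and s: "v rStart = s" "0 \<le> s" "s + 1 \<le> 2 ^ B" and n: "int (length es) + 1 \<le> 2 ^ B"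
  defines "h \<equiv> (length es + 1)\<^sup>2"
  defines "x \<equiv> (round_cells (rule_pairs es) ^^ h) (\<lambda>_. 0) (s, 0)"
  shows "wp B main_code (h * (round_steps (length es) + 3) + 11)
    (\<lambda>(v', m', inp', out'). out' = [if 0 < x then x - 1 else x]) (v, m, inp, [])"
proof -
  let ?I = "\<lambda>k (v', m', inp', out'). computing B es ((round_cells (rule_pairs es) ^^ k) (\<lambda>_. 0)) v' m' \<and>
    v' rStart = s \<and> v' rLoop = int h - int k \<and> out' = ([] :: int list)"
  have h: "(int (length es) + 1) * (int (length es) + 1) = int h"
    by (simp add: h_def power2_eq_square algebra_simps)
  have 1: "wp B (Basic (Add 14 rCount rOne) ;; Basic (Mult rLoop 14 14)) 2 (?I 0) (v, m, inp, [])"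
  proof -
    have "loop_free_wp B (Basic (Add 14 rCount rOne) ;; Basic (Mult rLoop 14 14)) (?I 0) (v, m, inp, [])"
      using comp s n h by (simp add: computing_def)
    from wp_loop_free[OF this] show ?thesis by (simp add: numeral_2_eq_2)
  qed
  have 2: "wp B (WhilePos rLoop (round_code ;; Basic (Sub rLoop rLoop rOne)))
    (h * ((round_steps (length es) + 1) + 2) + 2) (?I h) \<sigma>" if "?I 0 \<sigma>" for \<sigma>
  proof (rule wp_WhilePos[where I = ?I, OF _ _ _ that])
    fix k and \<sigma> :: store assume k: "k < h" "?I k \<sigma>"
    obtain v m inp out where \<sigma>: "\<sigma> = (v, m, inp, out)" by (metis prod_cases4)
    have comp: "computing B es ((round_cells (rule_pairs es) ^^ k) (\<lambda>_. 0)) v m" using k \<sigma> by simp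
    let ?R = "\<lambda>(v', m', inp', out'). computing B es (round_cells (rule_pairs es) ((round_cells (rule_pairs es) ^^ k) (\<lambda>_. 0))) v' m' \<and>
      (\<forall>r \<in> {5, 7}. v' r = v r) \<and> inp' = inp \<and> out' = out"
    have "wp B (Basic (Sub rLoop rLoop rOne)) 1 (?I (Suc k)) \<sigma>'" if "?R \<sigma>'" for \<sigma>'
    proof -
      have "loop_free_wp B (Basic (Sub rLoop rLoop rOne)) (?I (Suc k)) \<sigma>'"
        using that k \<sigma> by (auto simp: computing_def)
      from wp_loop_free[OF this] show ?thesis by simp
    qed
    with wp_round_code[OF comp] show "wp B (round_code ;; Basic (Sub rLoop rLoop rOne))
      (round_steps (length es) + 1) (?I (Suc k)) \<sigma>" unfolding \<sigma> by (rule wp_Seq_post)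
  qed auto
  have 3: "wp B (Basic (Add 14 rStart rOne) ;; Basic (Mult 14 14 rDim) ;; Basic (Load 14 14) ;;
    IfPos 14 (Basic (Sub 14 14 rOne)) Skip ;; Basic (Write 14)) 7
    (\<lambda>(v', m', inp', out'). out' = [if 0 < x then x - 1 else x]) \<sigma>" if I: "?I h \<sigma>" for \<sigma>
  proof -
    obtain v m inp out where \<sigma>: "\<sigma> = (v, m, inp, out)" by (metis prod_cases4)
    have D: "32 \<le> v 2" "v 2 \<le> 2 ^ B" using I \<sigma> by (auto simp: computing_def dim_ok_def)
    have "cells_at m (v 2) ((round_cells (rule_pairs es) ^^ h) (\<lambda>_. 0))"
      using I \<sigma> by (simp add: computing_def)
    from cells_atD[OF this s(2), of 0] have "m ((s + 1) * v 2 + 0) = x"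
      using D by (simp add: x_def)
    moreover have "v 2 \<le> (s + 1) * v 2 + 0" using s D by (intro cell_address_ge) auto
    then have "32 \<le> (s + 1) * v 2" using D(1) by linarith
    moreover have "v 5 = s" "v (Suc 0) = 1" "out = []" using I \<sigma> by (simp_all add: computing_def)
    moreover have "\<bar>s + 1\<bar> \<le> 2 ^ B" "\<bar>v 2\<bar> \<le> 2 ^ B" using s(2,3) D by simp_all
    ultimately have "loop_free_wp B (Basic (Add 14 rStart rOne) ;; Basic (Mult 14 14 rDim) ;; Basic (Load 14 14) ;;
      IfPos 14 (Basic (Sub 14 14 rOne)) Skip ;; Basic (Write 14))
      (\<lambda>(v', m', inp', out'). out' = [if 0 < x then x - 1 else x]) \<sigma>"
      by (simp add: \<sigma>)
    then show ?thesis by (rule wp_mono[OF wp_loop_free]) simp_all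
  qed
  have "wp B main_code (2 + (h * ((round_steps (length es) + 1) + 2) + 2 + 7))
    (\<lambda>(v', m', inp', out'). out' = [if 0 < x then x - 1 else x]) (v, m, inp, [])"
    unfolding main_code_def by (rule wp_Seq_post[OF 1 wp_Seq_post[OF 2 3]])
  then show ?thesis by (rule wp_mono) (simp_all add: algebra_simps)
qed

text \<open>\<open>B\<close> acts only as a guard on multiplications. The reading phase contains
  none and is executed with guard 0; the guard for the second phase is chosen from the values that
  reading produces, and the first phase is then lifted to it.\<close>

lemma exec_mono:
  assumes "B \<le> B'"
  shows "exec B c \<sigma> n \<sigma>' \<Longrightarrow> exec B' c \<sigma> n \<sigma>'"
proof (induction rule: exec.induct)
  case (Basic i \<sigma> \<sigma>')
  have "(2::int) ^ B \<le> 2 ^ B'" using assms by simp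
  then have le: "y \<le> 2 ^ B \<Longrightarrow> y \<le> 2 ^ B'" for y :: int by linarith
  have "basic B' i \<sigma> = Some \<sigma>'" using Basic by (cases i; cases \<sigma>) (auto split: if_splits intro: le)
  then show ?case by (rule exec.Basic)
next
  case (Seq c1 \<sigma> n1 \<sigma>' c2 n2 \<sigma>'')
  show ?case by (rule exec.Seq) fact+
next
  case (IfTrue \<sigma> j c1 n \<sigma>' c2)
  show ?case by (rule exec.IfTrue) fact+
next
  case (IfFalse \<sigma> j c2 n \<sigma>' c1)
  show ?case by (rule exec.IfFalse) fact+
next
  case (WhileTrue \<sigma> j c n \<sigma>' n' \<sigma>'')
  show ?case by (rule exec.WhileTrue) fact+
next
  case (WhileFalse \<sigma> j c)
  show ?case by (rule exec.WhileFalse) fact+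
qed (rule exec.Skip)

lemma exec_bits_bounded:
  assumes "exec B c \<sigma> n \<sigma>'" "2 * B \<le> K" "6 \<le> K" "bits_bounded K \<sigma>"
  shows "bits_bounded (K + n) \<sigma>'"
proof -
  obtain v m inp out where \<sigma>: "\<sigma> = (v, m, inp, out)" by (metis prod_cases4)
  obtain v' m' inp' out' where \<sigma>': "\<sigma>' = (v', m', inp', out')" by (metis prod_cases4)
  show ?thesis
    using compile_correct[OF assms, of "compile 0 c" "[]" "[]", simplified, OF \<sigma> \<sigma>'] by blast
qed

lemma computing_of_reading:
  assumes r: "reading es v m" and B: "v rDim \<le> 2 ^ B"
  shows "computing B es (\<lambda>_. 0) v m"
proof -
  have D: "32 + 8 * int (length es) < v rDim" using r by (simp add: reading_def dim_ok_def)
  have "m ((p + 1) * v rDim + q) = 0" if "0 \<le> p" "0 \<le> q" for p q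
    using cell_address_ge[OF that, of "v rDim"] D r by (simp add: reading_def)
  then show ?thesis using r B by (simp add: reading_def computing_def cells_at_def)
qed

text \<open>With \<open>k = code_length step_code\<close>, the left side is a cubic polynomial in
  \<open>n\<close> with coefficients \<open>k + 5\<close>, 9, 9 and 7, and \<open>k + 30\<close> is
  their sum.\<close>

lemma round_steps_le: "round_steps n + 3 \<le> (code_length step_code + 30) * (n + 1) ^ 3"
proof -
  define k where "k = code_length step_code"
  have "round_steps n + 3 \<le> (k + 30) * (n + 1) ^ 3"
    unfolding round_steps_def k_def[symmetric] by (simp add: power3_eq_cube algebra_simps)
  then show ?thesis by (simp add: k_def)
qed

section \<open>The whole program and its polynomial bound\<close>

definition program :: com where
  "program = read_input ;; main_code"

lemma input_le_input_size: "x \<in> set xs \<Longrightarrow> \<bar>x\<bar> \<le> 2 ^ input_size xs"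
proof -
  assume "x \<in> set xs"
  then have "bit_size x \<le> input_size xs"
    unfolding input_size_def by (intro member_le_sum_list) auto
  then show ?thesis
    using abs_le_power_bit_size[of x] power_increasing[of "bit_size x" "input_size xs" "2::int"] by linarith
qed

lemma length_le_input_size: "length xs \<le> input_size xs"
proof (induction xs)
  case (Cons x xs)
  have "1 \<le> bit_size x" by (simp add: bit_size_def)
  then show ?case using Cons by (simp add: input_size_def)
qed (simp add: input_size_def)

lemma length_all_edges: "length (all_edges A) = 2 * length (transition_list A) + 1"
proof -
  have "length (concat (map edges_of ts)) = 2 * length ts" for ts
    by (induction ts) auto
  then show ?thesis by (simp add: all_edges_def)
qed

lemma program_correct:
  assumes A: "is_pvass A" "bounded_pvass A"
  defines "S \<equiv> input_size (encode_pvass A)"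
  defines "k1 \<equiv> code_length read_input + 2" and "k2 \<equiv> code_length step_code + 41"
  shows "\<exists>n B rest v m. exec B program (\<lambda>_. 0, \<lambda>_. 0, encode_pvass A, []) n (v, m, rest, [\<lfloor>tight_bound A\<rfloor>]) \<and>
    B \<le> S + 7 + k1 * S \<and> n \<le> k1 * S + k2 * (S + 2) ^ 5"
proof -
  define es where "es = all_edges A"
  define \<sigma>0 :: store where "\<sigma>0 = (\<lambda>_. 0, \<lambda>_. 0, encode_pvass A, [])"
  obtain n1 \<sigma>1 where ex1: "exec 0 read_input \<sigma>0 n1 \<sigma>1" and n1: "n1 \<le> k1 * length (encode_pvass A)"
    and post: "(\<lambda>(v, m, inp, out). reading es v m \<and> v rStart = start_node A \<and> out = []) \<sigma>1"
    using wp_read_input[of 0 A] unfolding wp_def k1_def es_def \<sigma>0_def by blast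
  obtain v m inp out where \<sigma>1: "\<sigma>1 = (v, m, inp, out)" by (metis prod_cases4)
  have rd: "reading es v m" "v rStart = start_node A" "out = []" using post \<sigma>1 by simp_all
  have n1': "n1 \<le> k1 * S"
    using n1 length_le_input_size[of "encode_pvass A"] unfolding S_def by (meson le_trans mult_le_mono2)
  have "bits_bounded S \<sigma>0" using input_le_input_size unfolding \<sigma>0_def S_def by simp
  then have "bits_bounded (S + 6) \<sigma>0" by (rule bits_bounded_mono) simp
  from exec_bits_bounded[OF ex1 _ _ this] have "bits_bounded (S + 6 + n1) \<sigma>1" by simp
  then have bd: "\<bar>v r\<bar> \<le> 2 ^ (S + 6 + n1)" for r using \<sigma>1 by simp
  \<comment> \<open>One bit more than the registers need, because \<open>rStart\<close> and
    \<open>rCount\<close> are incremented before they are multiplied.\<close>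
  define B where "B = Suc (S + 6 + n1)"
  have bdB: "v r + 1 \<le> 2 ^ B" for r
  proof -
    have "(1::int) \<le> 2 ^ (S + 6 + n1)" by simp
    then show ?thesis using bd[of r] unfolding B_def power_Suc by linarith
  qed
  have comp: "computing B es (\<lambda>_. 0) v m"
    using bdB[of rDim] by (intro computing_of_reading rd) simp
  have start: "0 \<le> start_node A" "start_node A + 1 \<le> 2 ^ B" using bdB[of rStart] rd by (simp_all add: node_def)
  have "int (length es) + 1 \<le> 2 ^ B" using bdB[of rCount] rd by (simp add: reading_def)
  note wp = wp_main_code[OF comp rd(2) start this, of inp]
  define x where "x = (if goal_weights A = {} then 0 else Max (goal_weights A) + 1)"
  have x: "(if 0 < x then x - 1 else x) = \<lfloor>tight_bound A\<rfloor>"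
  proof (cases "goal_weights A = {}")
    case True
    then show ?thesis unfolding tight_bound_eq(2)[OF A] x_def by simp
  next
    case False
    then have "0 < Max (goal_weights A)"
      by (rule goal_weights_pos[OF A(1) Max_in[OF tight_bound_eq(1)[OF A]]])
    then show ?thesis using False unfolding tight_bound_eq(2)[OF A] x_def by simp
  qed
  have main: "wp B main_code ((length es + 1)\<^sup>2 * (round_steps (length es) + 3) + 11)
    (\<lambda>(v', m', inp', out'). out' = [\<lfloor>tight_bound A\<rfloor>]) \<sigma>1"
    using wp unfolding rounds_goal[OF A order_refl, folded es_def] x_def[symmetric] x \<sigma>1 rd(3) .
  then obtain n2 \<sigma>2 where ex2: "exec B main_code \<sigma>1 n2 \<sigma>2"
    and n2: "n2 \<le> (length es + 1)\<^sup>2 * (round_steps (length es) + 3) + 11"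
    and out: "(\<lambda>(v', m', inp', out'). out' = [\<lfloor>tight_bound A\<rfloor>]) \<sigma>2"
    unfolding wp_def by blast
  obtain v' m' rest where \<sigma>2: "\<sigma>2 = (v', m', rest, [\<lfloor>tight_bound A\<rfloor>])" using out by (cases \<sigma>2) auto
  have "exec B program \<sigma>0 (n1 + n2) \<sigma>2"
    unfolding program_def by (rule exec.Seq[OF exec_mono[OF _ ex1] ex2]) simp
  moreover have "B \<le> S + 7 + k1 * S" using n1' by (simp add: B_def)
  moreover have "n2 \<le> k2 * (S + 2) ^ 5"
  proof -
    let ?X = "length es + 1"
    have "5 * length (transition_list A) + 6 \<le> S"
      using length_le_input_size[of "encode_pvass A"] unfolding S_def length_encode_pvass by linarith
    then have X: "?X \<le> S + 2" unfolding es_def length_all_edges by linarith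
    let ?k = "code_length step_code + 30"
    have "n2 \<le> ?X\<^sup>2 * (?k * ?X ^ 3) + 11"
      using n2 mult_le_mono2[OF round_steps_le[of "length es"], of "?X\<^sup>2"] by linarith
    \<comment> \<open>The exponent 5 combines the squared number of rounds with the cubic length of
      a round; absorbing the additive 11 turns 30 into the 41 of \<open>k2\<close>.\<close>
    also have "\<dots> \<le> ?k * (?X\<^sup>2 * ?X ^ 3) + 11 * ?X ^ 5"
      unfolding mult.left_commute[of "?X\<^sup>2"] by (intro add_left_mono) simp
    also have "\<dots> = k2 * ?X ^ 5" unfolding k2_def power_add[symmetric] by (simp add: distrib_right)
    also have "\<dots> \<le> k2 * (S + 2) ^ 5" using X by (intro mult_le_mono2 power_mono) auto
    finally show ?thesis .
  qed
  ultimately show ?thesis using n1' \<sigma>0_def \<sigma>2 by (intro exI[of _ "n1 + n2"] exI[of _ B]) auto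
qed

lemma poly_time_program:
  "poly_time_computable_on {A :: (nat, nat) pvass. is_pvass A \<and> bounded_pvass A}
    encode_pvass (\<lambda>A. [\<lfloor>tight_bound A\<rfloor>])"
proof -
  define k1 where "k1 = code_length read_input + 2"
  define k2 where "k2 = code_length step_code + 41"
  define c where "c = (k1 + k2) * (2 * (2 * (7 + k1) + k1 + k2) + 2)"
  \<comment> \<open>The number of steps and the cost of a single step are both at most linear in
    \<open>(S + 2) ^ 5\<close>, which gives degree 10.\<close>
  define p :: "nat poly" where "p = smult c ([:2, 1:] ^ 10)"
  show ?thesis unfolding poly_time_computable_on_def
  proof (intro exI[of _ "compile 0 program"] exI[of _ p] ballI)
    fix A :: "(nat, nat) pvass" assume "A \<in> {A. is_pvass A \<and> bounded_pvass A}"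
    then have A: "is_pvass A" "bounded_pvass A" by auto
    define S where "S = input_size (encode_pvass A)"
    define Y where "Y = (S + 2) ^ 5"
    obtain n B rest v m where ex: "exec B program (\<lambda>_. 0, \<lambda>_. 0, encode_pvass A, []) n (v, m, rest, [\<lfloor>tight_bound A\<rfloor>])"
      and B: "B \<le> S + 7 + k1 * S" and n: "n \<le> k1 * S + k2 * Y"
      using program_correct[OF A] unfolding S_def k1_def k2_def Y_def by blast
    define K where "K = 2 * (S + 7 + k1 * S)"
    have "(2::int) ^ S \<le> 2 ^ K" unfolding K_def by (intro power_increasing) auto
    then have "\<forall>x\<in>set (encode_pvass A). \<bar>x\<bar> \<le> 2 ^ K"
      using input_le_input_size[of _ "encode_pvass A"] unfolding S_def[symmetric] by (meson order_trans)
    with compile_outputs[OF ex, of K] B obtain t where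
      t: "t \<le> n * (2 * (K + n) + 2)" "ram_outputs (compile 0 program) (encode_pvass A) [\<lfloor>tight_bound A\<rfloor>] t"
      unfolding K_def by auto
    have "(S + 2) ^ 1 \<le> Y" unfolding Y_def by (intro power_increasing) auto
    then have SY: "S + 2 \<le> Y" by simp
    have nY: "n \<le> (k1 + k2) * Y"
    proof -
      have "k1 * S \<le> k1 * Y" using SY by (intro mult_le_mono2) simp
      then show ?thesis using n unfolding distrib_right by linarith
    qed
    have KY: "K \<le> 2 * (7 + k1) * Y"
    proof -
      have "k1 * S \<le> k1 * Y" using SY by (intro mult_le_mono2) simp
      moreover have "7 \<le> 7 * Y" "S + 7 \<le> 7 * Y" using SY by linarith+
      ultimately have "S + 7 + k1 * S \<le> (7 + k1) * Y" unfolding distrib_right by linarith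
      then show ?thesis unfolding K_def mult.assoc by (rule mult_le_mono2)
    qed
    have "2 * (K + n) + 2 \<le> (2 * (2 * (7 + k1) + k1 + k2) + 2) * Y"
      using nY KY SY by (simp add: algebra_simps)
    then have "n * (2 * (K + n) + 2) \<le> ((k1 + k2) * Y) * ((2 * (2 * (7 + k1) + k1 + k2) + 2) * Y)"
      using nY by (rule mult_le_mono[rotated])
    also have "\<dots> = c * (Y * Y)" by (simp add: c_def)
    also have "\<dots> = c * (S + 2) ^ 10" by (simp add: Y_def flip: power_add)
    also have "\<dots> = poly p S" by (simp add: p_def add.commute)
    finally show "\<exists>t\<le>poly p (input_size (encode_pvass A)).
      ram_outputs (compile 0 program) (encode_pvass A) [\<lfloor>tight_bound A\<rfloor>] t"
      using t unfolding S_def by (meson le_trans)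
  qed
qed

theorem theorem3p10:
  shows "(\<forall>A :: (nat, nat) pvass. is_pvass A \<and> bounded_pvass A \<longrightarrow> tight_bound A \<in> \<nat>) \<and>
    poly_time_computable_on {A :: (nat, nat) pvass. is_pvass A \<and> bounded_pvass A}
      encode_pvass (\<lambda>A. [\<lfloor>tight_bound A\<rfloor>])"
  using tight_bound_Nats poly_time_program by blast

end
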